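(* An operator algebra $A$ has a contractive approximate identity if and only if the linear span of $\mathfrak{F}_A$ is norm dense in $A$.
   Context: An operator algebra is a norm closed algebra $A$ of operators on a Hilbert space $H$, not assumed to have an identity. The unitization $A^1$ equals $A$ if $A$ has an identity of norm $1$, and otherwise is $A + \mathbb{C} I_H$ (by a theorem of Meyer it does not depend on the completely isometric representation); $1$ is the identity of $A^1$. $\mathfrak{F}_A = \{ x \in A : \Vert 1 - x \Vert_{A^1} \leq 1 \}$. A contractive approximate identity is a net $(e_t)$ in the closed unit ball of $A$ with $e_t x \to x$ and $x e_t \to x$ in norm for all $x \in A$. *)

theory Defs
  imports "HOL-Analysis.Analysis"
begin

section \<open>Complex Hilbert spaces\<close>

text \<open>Positivity and definiteness of the inner product are contained in the axiom
  \<open>cinner_self\<close>, since \<open>norm\<close> is a norm; completeness comes from \<^class>\<open>banach\<close>.\<close>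

class chilbert_space = banach +
  fixes scaleC :: "complex \<Rightarrow> 'a \<Rightarrow> 'a"  (infixr "*\<^sub>C" 75)
    and cinner :: "'a \<Rightarrow> 'a \<Rightarrow> complex"
  assumes scaleC_add_right: "c *\<^sub>C (x + y) = c *\<^sub>C x + c *\<^sub>C y"
    and scaleC_add_left: "(c + d) *\<^sub>C x = c *\<^sub>C x + d *\<^sub>C x"
    and scaleC_scaleC: "c *\<^sub>C (d *\<^sub>C x) = (c * d) *\<^sub>C x"
    and scaleC_of_real: "complex_of_real r *\<^sub>C x = r *\<^sub>R x"
    and cinner_commute: "cinner x y = cnj (cinner y x)"
    and cinner_add_left: "cinner (x + y) z = cinner x z + cinner y z"
    and cinner_scaleC_left: "cinner (c *\<^sub>C x) y = c * cinner x y"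
    and cinner_self: "cinner x x = complex_of_real ((norm x)\<^sup>2)"

lemma norm_scaleC: "norm (c *\<^sub>C x) = cmod c * norm (x :: 'a::chilbert_space)"
proof -
  have "complex_of_real ((norm (c *\<^sub>C x))\<^sup>2) = cinner (c *\<^sub>C x) (c *\<^sub>C x)"
    by (simp add: cinner_self)
  also have "\<dots> = c * cnj (c * cinner x x)"
    using cinner_commute[of x "c *\<^sub>C x"] by (simp add: cinner_scaleC_left)
  also have "\<dots> = (c * cnj c) * complex_of_real ((norm x)\<^sup>2)"
    by (simp add: cinner_self)
  also have "\<dots> = complex_of_real ((cmod c * norm x)\<^sup>2)"
    by (simp add: complex_norm_square[symmetric] power_mult_distrib)
  finally have "(norm (c *\<^sub>C x))\<^sup>2 = (cmod c * norm x)\<^sup>2"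
    by (simp only: of_real_eq_iff)
  then show ?thesis
    by simp
qed

lemma bounded_linear_scaleC: "bounded_linear (\<lambda>x :: 'a::chilbert_space. c *\<^sub>C x)"
proof (rule bounded_linear_intro[where K = "cmod c"])
  fix r and x y :: 'a
  show "c *\<^sub>C (x + y) = c *\<^sub>C x + c *\<^sub>C y"
    by (rule scaleC_add_right)
  show "c *\<^sub>C (r *\<^sub>R x) = r *\<^sub>R (c *\<^sub>C x)"
    by (simp only: scaleC_of_real[symmetric] scaleC_scaleC mult.commute)
  show "norm (c *\<^sub>C x) \<le> norm x * cmod c"
    by (simp add: norm_scaleC)
qed

instantiation complex :: chilbert_space
begin

definition "scaleC_complex (c :: complex) (x :: complex) = c * x"
definition "cinner_complex (x :: complex) (y :: complex) = x * cnj y"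

instance
proof
  fix x :: complex
  show "cinner x x = complex_of_real ((norm x)\<^sup>2)"
    unfolding cinner_complex_def by (rule complex_norm_square[symmetric])
qed (simp_all add: scaleC_complex_def cinner_complex_def ring_distribs scaleR_conv_of_real)

end


section \<open>Operator algebras\<close>

text \<open>The library type \<open>'h \<Rightarrow>\<^sub>L 'h\<close> consists of the bounded real-linear maps, with the operator
  norm. The operators on the Hilbert space \<open>'h\<close> are the complex-linear ones among them.\<close>

type_synonym 'h op = "'h \<Rightarrow>\<^sub>L 'h"

definition complex_linear :: "'h::chilbert_space op \<Rightarrow> bool" where
  "complex_linear f \<longleftrightarrow> (\<forall>c x. blinfun_apply f (c *\<^sub>C x) = c *\<^sub>C blinfun_apply f x)"

lift_definition scale_op :: "complex \<Rightarrow> 'h::chilbert_space op \<Rightarrow> 'h op" is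
  "\<lambda>c f x. c *\<^sub>C f x"
  by (rule bounded_linear_compose[OF bounded_linear_scaleC])

global_interpretation op: vector_space "scale_op :: complex \<Rightarrow> 'h::chilbert_space op \<Rightarrow> 'h op"
proof
  fix a b :: complex and f g :: "'h op"
  show "scale_op a (f + g) = scale_op a f + scale_op a g"
    by (rule blinfun_eqI) (simp add: scale_op.rep_eq plus_blinfun.rep_eq scaleC_add_right)
  show "scale_op (a + b) f = scale_op a f + scale_op b f"
    by (rule blinfun_eqI) (simp add: scale_op.rep_eq plus_blinfun.rep_eq scaleC_add_left)
  show "scale_op a (scale_op b f) = scale_op (a * b) f"
    by (rule blinfun_eqI) (simp add: scale_op.rep_eq scaleC_scaleC)
  show "scale_op 1 f = f"
    using scaleC_of_real[of 1] by (intro blinfun_eqI) (simp add: scale_op.rep_eq)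
qed

definition operator_algebra :: "'h::chilbert_space op set \<Rightarrow> bool" where
  "operator_algebra A \<longleftrightarrow>
     (\<forall>f\<in>A. complex_linear f) \<and> op.subspace A \<and> (\<forall>f\<in>A. \<forall>g\<in>A. f o\<^sub>L g \<in> A) \<and> closed A"


section \<open>Unitization\<close>

definition is_identity :: "'h::chilbert_space op set \<Rightarrow> 'h op \<Rightarrow> bool" where
  "is_identity A e \<longleftrightarrow> e \<in> A \<and> (\<forall>x\<in>A. e o\<^sub>L x = x \<and> x o\<^sub>L e = x)"

definition unitization :: "'h::chilbert_space op set \<Rightarrow> 'h op set" where
  "unitization A =
     (if \<exists>e. is_identity A e \<and> norm e = 1 then A
      else {a + scale_op c id_blinfun | a c. a \<in> A})"

text \<open>If \<open>A\<close> has an identity of norm 1, the following is that identity (a projection, in general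
  different from the identity operator of \<open>'h\<close>); otherwise it is the identity operator.\<close>

definition unit_of :: "'h::chilbert_space op set \<Rightarrow> 'h op" where
  "unit_of A = (THE e. is_identity (unitization A) e)"

definition F_set :: "'h::chilbert_space op set \<Rightarrow> 'h op set" where
  "F_set A = {x \<in> A. norm (unit_of A - x) \<le> 1}"

lemma is_identity_unique: "is_identity A e \<Longrightarrow> is_identity A e' \<Longrightarrow> e = e'"
  unfolding is_identity_def by metis

lemma unit_of_eq:
  assumes "is_identity A e" "norm e = 1"
  shows "unit_of A = e"
proof -
  have "unitization A = A"
    using assms by (auto simp: unitization_def)
  then show ?thesis
    unfolding unit_of_def using assms is_identity_unique by (metis the_equality)
qed

lemma unit_of_eq_id:
  assumes "operator_algebra A" "\<nexists>e. is_identity A e \<and> norm e = 1"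
  shows "unit_of A = id_blinfun"
proof -
  have u: "unitization A = {a + scale_op c id_blinfun | a c. a \<in> A}"
    unfolding unitization_def using assms(2) by (rule if_not_P)
  have "0 \<in> A"
    using assms(1) by (simp add: operator_algebra_def op.subspace_0)
  then have "0 + scale_op 1 id_blinfun \<in> unitization A"
    unfolding u by blast
  then have "is_identity (unitization A) id_blinfun"
    by (auto simp: is_identity_def intro!: blinfun_eqI)
  then show ?thesis
    unfolding unit_of_def using is_identity_unique by (metis the_equality)
qed


section \<open>Nets and contractive approximate identities\<close>

definition directed_set :: "'i set \<Rightarrow> ('i \<Rightarrow> 'i \<Rightarrow> bool) \<Rightarrow> bool" where
  "directed_set I le \<longleftrightarrow> I \<noteq> {} \<and> (\<forall>i\<in>I. le i i) \<and>
     (\<forall>i\<in>I. \<forall>j\<in>I. \<forall>k\<in>I. le i j \<longrightarrow> le j k \<longrightarrow> le i k) \<and>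
     (\<forall>i\<in>I. \<forall>j\<in>I. \<exists>k\<in>I. le i k \<and> le j k)"

text \<open>Convergence of a net indexed by \<open>I\<close> is convergence along its filter of tails.\<close>

definition tail_filter :: "'i set \<Rightarrow> ('i \<Rightarrow> 'i \<Rightarrow> bool) \<Rightarrow> 'i filter" where
  "tail_filter I le = (INF i\<in>I. principal {j \<in> I. le i j})"

definition is_cai ::
    "'h::chilbert_space op set \<Rightarrow> 'i set \<Rightarrow> ('i \<Rightarrow> 'i \<Rightarrow> bool) \<Rightarrow> ('i \<Rightarrow> 'h op) \<Rightarrow> bool" where
  "is_cai A I le e \<longleftrightarrow> directed_set I le \<and> (\<forall>t\<in>I. e t \<in> A \<and> norm (e t) \<le> 1) \<and>
     (\<forall>x\<in>A. ((\<lambda>t. e t o\<^sub>L x) \<longlongrightarrow> x) (tail_filter I le) \<and>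
            ((\<lambda>t. x o\<^sub>L e t) \<longlongrightarrow> x) (tail_filter I le))"

text \<open>The index type cannot be quantified in HOL. The one chosen here is large enough: by
  \<open>is_cai_imp_has_cai\<close> below, a contractive approximate identity over any index type yields one
  over this type.\<close>

definition has_cai :: "'h::chilbert_space op set \<Rightarrow> bool" where
  "has_cai A \<longleftrightarrow> (\<exists>(I :: ('h op \<times> 'h op set) set) le e. is_cai A I le e)"

lemma eventually_tail_filter:
  assumes "directed_set I le"
  shows "eventually P (tail_filter I le) \<longleftrightarrow> (\<exists>i\<in>I. \<forall>j\<in>I. le i j \<longrightarrow> P j)"
proof -
  have "eventually P (tail_filter I le) \<longleftrightarrow>
      (\<exists>i\<in>I. eventually P (principal {j \<in> I. le i j}))"
    unfolding tail_filter_def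
  proof (rule eventually_INF_base)
    show "I \<noteq> {}"
      using assms by (simp add: directed_set_def)
    fix i j assume ij: "i \<in> I" "j \<in> I"
    then obtain k where k: "k \<in> I" "le i k" "le j k"
      using assms unfolding directed_set_def by meson
    have "{l \<in> I. le k l} \<subseteq> {l \<in> I. le i l} \<inter> {l \<in> I. le j l}"
      using assms ij k unfolding directed_set_def by blast
    then show "\<exists>k\<in>I. principal {l \<in> I. le k l} \<le>
        inf (principal {l \<in> I. le i l}) (principal {l \<in> I. le j l})"
      using k(1) by auto
  qed
  then show ?thesis
    by (auto simp: eventually_principal)
qed

lemma is_cai_imp_filter:
  assumes "is_cai A I le e"
  shows "\<exists>F. F \<noteq> bot \<and> eventually (\<lambda>f. f \<in> A \<and> norm f \<le> 1) F \<and>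
    (\<forall>x\<in>A. ((\<lambda>f. f o\<^sub>L x) \<longlongrightarrow> x) F \<and> ((\<lambda>f. x o\<^sub>L f) \<longlongrightarrow> x) F)"
proof -
  have d: "directed_set I le"
    using assms by (simp add: is_cai_def)
  then have "I \<noteq> {}" "\<forall>i\<in>I. le i i"
    by (auto simp: directed_set_def)
  then have "tail_filter I le \<noteq> bot"
    unfolding trivial_limit_def eventually_tail_filter[OF d] by blast
  moreover have "eventually (\<lambda>t. e t \<in> A \<and> norm (e t) \<le> 1) (tail_filter I le)"
    unfolding eventually_tail_filter[OF d]
    using assms \<open>I \<noteq> {}\<close> by (auto simp: is_cai_def)
  ultimately show ?thesis
    using assms
    by (intro exI[where x = "filtermap e (tail_filter I le)"])
      (auto simp: is_cai_def filtermap_bot_iff eventually_filtermap filterlim_filtermap)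
qed

lemma filter_imp_has_cai:
  assumes "F \<noteq> bot" and F: "eventually (\<lambda>f. f \<in> A \<and> norm f \<le> 1) F"
    and lim: "\<forall>x\<in>A. ((\<lambda>f. f o\<^sub>L x) \<longlongrightarrow> x) F \<and> ((\<lambda>f. x o\<^sub>L f) \<longlongrightarrow> x) F"
  shows "has_cai A"
proof -
  define I where
    "I = {(f, S). f \<in> S \<and> S \<subseteq> {f \<in> A. norm f \<le> 1} \<and> eventually (\<lambda>g. g \<in> S) F}"
  define le where "le = (\<lambda>(p :: 'a op \<times> 'a op set) (q :: 'a op \<times> 'a op set). snd q \<subseteq> snd p)"
  have inI: "\<exists>f. (f, S) \<in> I"
    if "S \<subseteq> {f \<in> A. norm f \<le> 1}" "eventually (\<lambda>g. g \<in> S) F" for S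
    using eventually_happens'[OF \<open>F \<noteq> bot\<close> that(2)] that unfolding I_def by auto
  have d: "directed_set I le"
    unfolding directed_set_def
  proof (intro conjI ballI impI)
    show "I \<noteq> {}"
      using inI[of "{f \<in> A. norm f \<le> 1}"] F by auto
    fix p assume p: "p \<in> I"
    show "le p p"
      by (simp add: le_def)
    fix q assume q: "q \<in> I"
    have ev: "eventually (\<lambda>g. g \<in> snd p \<inter> snd q) F"
      using p q by (auto simp: I_def intro: eventually_conj)
    have "snd p \<inter> snd q \<subseteq> {f \<in> A. norm f \<le> 1}"
      using p by (auto simp: I_def)
    then obtain f where "(f, snd p \<inter> snd q) \<in> I"
      using inI ev by blast
    then show "\<exists>k\<in>I. le p k \<and> le q k"
      by (intro bexI[of _ "(f, snd p \<inter> snd q)"]) (auto simp: le_def)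
  qed (auto simp: le_def)
  have ev: "eventually (\<lambda>t. P (fst t)) (tail_filter I le)" if P: "eventually P F" for P
  proof -
    have "eventually (\<lambda>g. g \<in> {f \<in> A. norm f \<le> 1 \<and> P f}) F"
      using eventually_conj[OF F P] by simp
    then obtain f where "(f, {f \<in> A. norm f \<le> 1 \<and> P f}) \<in> I"
      using inI[of "{f \<in> A. norm f \<le> 1 \<and> P f}"] by auto
    then show ?thesis
      unfolding eventually_tail_filter[OF d]
      by (rule bexI[rotated]) (auto simp: le_def I_def)
  qed
  have "filterlim fst F (tail_filter I le)"
    using ev by (simp add: filterlim_iff)
  then have "is_cai A I le fst"
    unfolding is_cai_def
    using d lim by (auto simp: I_def intro: filterlim_compose)
  then show ?thesis
    unfolding has_cai_def by blast
qed

lemma is_cai_imp_has_cai: "is_cai A I le e \<Longrightarrow> has_cai A"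
  using is_cai_imp_filter[of A I le e] filter_imp_has_cai by blast

end

theory Submission
  imports Defs
begin

text \<open>
  Write \<open>F\<close> for the set of \<open>x \<in> A\<close> with \<open>\<parallel>id - x\<parallel> \<le> 1\<close>, where \<open>id\<close> is the identity operator of the
  Hilbert space. It is contained in \<^const>\<open>F_set\<close> and equal to it when \<open>A\<close> has no identity of norm 1;
  when it has one, that identity is already a contractive approximate identity. The condition on
  \<open>x\<close> says that \<open>x\<^sup>* x \<le> 2 Re x\<close>, and equally that \<open>x x\<^sup>* \<le> 2 Re x\<close>. The argument uses quadratic
  forms \<open>Re \<langle>x v, v\<rangle>\<close> only; adjoints appear nowhere except as motivation.

  Dense span gives an approximate identity. For finitely many \<open>x\<^sub>1, \<dots>, x\<^sub>N \<in> F\<close> the average \<open>z\<close> is again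
  in \<open>F\<close>, and \<open>Re x\<^sub>i \<le> N Re z\<close>. Since \<open>z\<close> is accretive, \<open>e = \<lambda>z(1 + \<lambda>z)\<inverse>\<close> is a contraction in \<open>A\<close> for
  every \<open>\<lambda> > 0\<close>. As \<open>\<lambda>\<close> grows, \<open>Re \<langle>z w, w\<rangle>\<close> is \<open>O(1/\<lambda>)\<close> on the vectors
  \<open>w = (1 - e) v\<close> with \<open>\<parallel>v\<parallel> \<le> 1\<close>. The two bounds on \<open>x\<^sub>i\<close> turn this into \<open>\<parallel>x\<^sub>i (1 - e)\<parallel> \<rightarrow> 0\<close> and
  \<open>\<parallel>(1 - e) x\<^sub>i\<parallel> \<rightarrow> 0\<close>, so that \<open>e\<close> is an approximate unit for all \<open>x\<^sub>i\<close> on both sides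
  (\<open>resolvent_approximates\<close>). These contractions form a net, and the elements for which a
  contractive net is an approximate unit form a closed subspace.

  An approximate identity gives dense span. Every accretive \<open>w \<in> A\<close> is in the closed span of \<open>F\<close>,
  because \<open>c w(1 + c w)\<inverse> \<in> F\<close> and \<open>w = lim w(1 + c w)\<inverse>\<close> as \<open>c \<rightarrow> 0\<close>
  (\<open>accretive_in_closure_span\<close>). It remains to find accretive elements. Choose \<open>e\<^sub>1, \<dots>, e\<^sub>n\<close> from the
  approximate identity such that each is almost a left unit for its predecessors. A contraction
  that fixes a vector has an adjoint that fixes it, so \<open>\<langle>e\<^sub>k v, e\<^sub>j v\<rangle> \<approx> \<langle>v, e\<^sub>j v\<rangle>\<close> for \<open>j < k\<close>, and with
  \<open>u = \<Sum>\<^sub>k e\<^sub>k\<close>, \<open>Y = \<Sum>\<^sub>j\<^sub><\<^sub>k e\<^sub>j\<close> the square \<open>\<parallel>u v\<parallel>\<^sup>2\<close> expands to at most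
  \<open>n\<parallel>v\<parallel>\<^sup>2 + 2 Re \<langle>Y v, v\<rangle>\<close>, up to small errors. Hence \<open>y = 2Y/n\<^sup>2\<close>, which has norm at most 1,
  satisfies \<open>Re y \<ge> -O(1/n)\<close>. If the \<open>e\<^sub>k\<close> are almost units for \<open>x\<close> too, then
  \<open>Re \<langle>x v, v\<rangle> \<approx> Re \<langle>x u v, u v\<rangle>/n\<^sup>2\<close>, and from \<open>Re x \<ge> -\<epsilon>\<close> it follows that \<open>Re (x + \<epsilon>y) \<ge> -O(1/n)\<close>
  (\<open>ex_almost_positive_summand\<close>). Adding such corrections with \<open>\<epsilon>\<close> halved each time gives an exactly
  accretive element at distance at most \<open>2\<epsilon>\<close> from \<open>x\<close> (\<open>ex_accretive_near\<close>). Given \<open>a \<in> A\<close> and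
  \<open>M \<ge> \<parallel>a\<parallel>\<close>, there is \<open>y\<close> such that both \<open>y\<close> and \<open>a + My\<close> are nearly accretive; so \<open>a\<close> is
  approximated by differences of multiples of accretive elements of \<open>A\<close>.
\<close>

section \<open>The real inner product and the real part of an operator\<close>

definition rinner :: "'h::chilbert_space \<Rightarrow> 'h \<Rightarrow> real" where
  "rinner x y = Re (cinner x y)"

lemma rinner_self: "rinner x x = (norm x)\<^sup>2"
  by (simp add: rinner_def cinner_self)

lemma rinner_commute: "rinner x y = rinner y x"
  unfolding rinner_def by (subst cinner_commute) simp

lemma rinner_add_left: "rinner (x + y) z = rinner x z + rinner y z"
  by (simp add: rinner_def cinner_add_left)

lemma rinner_scaleR_left: "rinner (r *\<^sub>R x) y = r * rinner x y"
  unfolding rinner_def scaleC_of_real[symmetric] cinner_scaleC_left by simp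

lemma rinner_add_right: "rinner x (y + z) = rinner x y + rinner x z"
  using rinner_add_left[of y z x] by (simp only: rinner_commute[of _ x])

lemma rinner_scaleR_right: "rinner x (r *\<^sub>R y) = r * rinner x y"
  using rinner_scaleR_left[of r y x] by (simp only: rinner_commute[of _ x])

lemma norm_add_scaleR_sq:
  "(norm (x + t *\<^sub>R y))\<^sup>2 = (norm x)\<^sup>2 + 2 * t * rinner x y + t\<^sup>2 * (norm y)\<^sup>2"
  unfolding rinner_self[symmetric] rinner_add_left rinner_add_right rinner_scaleR_left
    rinner_scaleR_right rinner_commute[of y x]
  by (simp add: algebra_simps power2_eq_square)

lemma rinner_le_norm: "rinner x y \<le> norm x * norm y"
proof (cases "x = 0 \<or> y = 0")
  case True
  then show ?thesis
    using rinner_scaleR_left[of 0 0 y] rinner_scaleR_left[of 0 0 x] rinner_commute[of x y] by auto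
next
  case False
  then have p: "norm x > 0" "norm y > 0"
    by auto
  have "0 \<le> (norm x)\<^sup>2 + 2 * (- norm x / norm y) * rinner x y
      + (- norm x / norm y)\<^sup>2 * (norm y)\<^sup>2"
    unfolding norm_add_scaleR_sq[symmetric] by simp
  also have "\<dots> = 2 * (norm x / norm y) * (norm x * norm y - rinner x y)"
    using p by (simp add: field_simps power2_eq_square)
  finally show ?thesis
    using p by (simp add: zero_le_mult_iff zero_le_divide_iff)
qed

lemma bounded_bilinear_rinner: "bounded_bilinear rinner"
proof
  fix a a' b b' :: 'a and r :: real
  show "rinner (a + a') b = rinner a b + rinner a' b"
    by (rule rinner_add_left)
  show "rinner a (b + b') = rinner a b + rinner a b'"
    by (rule rinner_add_right)
  show "rinner (r *\<^sub>R a) b = r *\<^sub>R rinner a b" "rinner a (r *\<^sub>R b) = r *\<^sub>R rinner a b"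
    by (simp_all add: rinner_scaleR_left rinner_scaleR_right)
  have "\<bar>rinner a b\<bar> \<le> norm a * norm b" for a b :: 'a
    using rinner_le_norm[of a b] rinner_le_norm[of "- a" b] rinner_scaleR_left[of "-1" a b] by auto
  then show "\<exists>K. \<forall>a b :: 'a. norm (rinner a b) \<le> norm a * norm b * K"
    by (intro exI[of _ 1]) simp
qed

interpretation rinner: bounded_bilinear rinner
  by (rule bounded_bilinear_rinner)

lemma abs_rinner_le: "\<bar>rinner x y\<bar> \<le> norm x * norm y"
  using rinner_le_norm[of x y] rinner_le_norm[of "- x" y] by (simp add: rinner.minus_left abs_le_iff)

text \<open>\<open>re_ge c x\<close> is the operator inequality \<open>Re x \<ge> c\<close>, where \<open>Re x = (x + x\<^sup>*)/2\<close>, written with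
  the quadratic form so that it needs no adjoint.\<close>

definition re_ge :: "real \<Rightarrow> 'h::chilbert_space op \<Rightarrow> bool" where
  "re_ge c x \<longleftrightarrow> (\<forall>v. c * (norm v)\<^sup>2 \<le> rinner (x v) v)"

abbreviation accretive :: "'h::chilbert_space op \<Rightarrow> bool" where
  "accretive \<equiv> re_ge 0"

lemma re_ge_norm: "re_ge (- norm x) x"
  unfolding re_ge_def
proof
  fix v
  have "\<bar>rinner (x v) v\<bar> \<le> norm (x v) * norm v"
    by (rule abs_rinner_le)
  also have "\<dots> \<le> (norm x * norm v) * norm v"
    by (intro mult_right_mono norm_blinfun) auto
  finally show "- norm x * (norm v)\<^sup>2 \<le> rinner (x v) v"
    by (simp add: power2_eq_square)
qed

lemma re_ge_mono: "re_ge c x \<Longrightarrow> d \<le> c \<Longrightarrow> re_ge d x"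
  unfolding re_ge_def by (meson mult_right_mono order_trans zero_le_power2)

lemma norm_blinfun_le_oneD: "norm f \<le> 1 \<Longrightarrow> norm (blinfun_apply f v) \<le> norm v"
  using norm_blinfun[of f v] by (meson mult_left_le_one_le norm_ge_zero order_trans)

text \<open>This is \<open>x\<^sup>* x \<le> 2 Re x\<close>: expand \<open>\<parallel>v - x v\<parallel>\<^sup>2 \<le> \<parallel>v\<parallel>\<^sup>2\<close>.\<close>

lemma two_rinner_ge_norm_sq:
  assumes "norm (id_blinfun - x) \<le> 1"
  shows "(norm (x v))\<^sup>2 \<le> 2 * rinner (x v) v"
proof -
  have "norm (v - x v) \<le> norm v"
    using norm_blinfun_le_oneD[OF assms, of v] by (simp add: blinfun.diff_left)
  then have "(norm (v + (-1) *\<^sub>R x v))\<^sup>2 \<le> (norm v)\<^sup>2"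
    by (simp add: power_mono)
  then show ?thesis
    unfolding norm_add_scaleR_sq by (simp add: rinner_commute)
qed

text \<open>The companion inequality \<open>x x\<^sup>* \<le> 2 Re x\<close>. Optimizing over \<open>s\<close> turns the bound below into
  \<open>Re \<langle>x w, v\<rangle>\<^sup>2 \<le> 2 Re \<langle>x v, v\<rangle> \<parallel>w\<parallel>\<^sup>2\<close>; the form with \<open>s\<close> says the same without a square root. It comes
  from \<open>2 Re \<langle>T a, v\<rangle> \<le> \<parallel>a\<parallel>\<^sup>2 + \<parallel>v\<parallel>\<^sup>2\<close> for the contraction \<open>T = id - x\<close> and \<open>a = v - s w\<close>.\<close>

lemma two_rinner_le_form_plus_norm_sq:
  assumes "norm (id_blinfun - x) \<le> 1"
  shows "2 * s * rinner (x w) v \<le> 2 * rinner (x v) v + s\<^sup>2 * (norm w)\<^sup>2"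
proof -
  define a where "a = v + (- s) *\<^sub>R w"
  have "rinner (a - x a) v \<le> norm (a - x a) * norm v"
    by (rule rinner_le_norm)
  also have "\<dots> \<le> norm a * norm v"
    using norm_blinfun_le_oneD[OF assms, of a] by (intro mult_right_mono) (auto simp: blinfun.diff_left)
  also have "\<dots> \<le> ((norm a)\<^sup>2 + (norm v)\<^sup>2) / 2"
    using sum_squares_bound[of "norm a" "norm v"] by simp
  finally have "2 * rinner (a - x a) v \<le> (norm a)\<^sup>2 + (norm v)\<^sup>2"
    by simp
  then show ?thesis
    unfolding a_def norm_add_scaleR_sq
    by (simp add: blinfun.diff_right blinfun.add_right blinfun.scaleR_right rinner.diff_left
        rinner.add_left rinner.scaleR_left rinner_self rinner.minus_left blinfun.minus_right
        rinner_commute[of v w] algebra_simps)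
qed

section \<open>Resolvents\<close>

lemma scale_op_of_real: "scale_op (complex_of_real r) x = r *\<^sub>R x"
  by (rule blinfun_eqI) (simp add: scale_op.rep_eq scaleC_of_real scaleR_blinfun.rep_eq)

lemma operator_algebra_scaleR: "operator_algebra A \<Longrightarrow> x \<in> A \<Longrightarrow> r *\<^sub>R x \<in> A"
  by (simp add: operator_algebra_def op.subspace_scale flip: scale_op_of_real)

lemma
  assumes "operator_algebra A" "x \<in> A" "y \<in> A"
  shows operator_algebra_add: "x + y \<in> A"
    and operator_algebra_diff: "x - y \<in> A"
    and operator_algebra_compose: "x o\<^sub>L y \<in> A"
  using assms by (auto simp: operator_algebra_def op.subspace_add op.subspace_diff)

lemma operator_algebra_zero: "operator_algebra A \<Longrightarrow> 0 \<in> A"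
  by (simp add: operator_algebra_def op.subspace_0)

lemmas compose_simps = bounded_bilinear.diff_left[OF bounded_bilinear_blinfun_compose]
  bounded_bilinear.diff_right[OF bounded_bilinear_blinfun_compose]
  bounded_bilinear.add_left[OF bounded_bilinear_blinfun_compose]
  bounded_bilinear.add_right[OF bounded_bilinear_blinfun_compose]
  bounded_bilinear.scaleR_left[OF bounded_bilinear_blinfun_compose]
  bounded_bilinear.scaleR_right[OF bounded_bilinear_blinfun_compose]

lemma id_compose [simp]: "id_blinfun o\<^sub>L f = f" "f o\<^sub>L id_blinfun = f"
  by (auto intro!: blinfun_eqI)

text \<open>The multiplier \<open>s\<close> may lie outside \<open>A\<close>, as for the multiples of \<open>id - z\<close> below. Banach's fixed
  point theorem in the complete set \<open>A\<close> replaces the Neumann series and at once puts the solution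
  into \<open>A\<close>.\<close>

lemma ex_left_fixpoint:
  fixes s p :: "'h::chilbert_space op"
  assumes A: "operator_algebra A" and p: "p \<in> A" and s: "norm s < 1"
    and sA: "\<And>x. x \<in> A \<Longrightarrow> s o\<^sub>L x \<in> A"
  shows "\<exists>e\<in>A. p + (s o\<^sub>L e) = e"
proof -
  have "\<exists>!e\<in>A. p + (s o\<^sub>L e) = e"
  proof (rule Banach_fix)
    show "complete A"
      using A by (simp add: operator_algebra_def complete_eq_closed)
    show "A \<noteq> {}"
      using p by auto
    show "0 \<le> norm s" "norm s < 1"
      using s by auto
    show "(\<lambda>e. p + (s o\<^sub>L e)) ` A \<subseteq> A"
      using operator_algebra_add[OF A p sA] by auto
    fix x y :: "'h op"
    have "dist (p + (s o\<^sub>L x)) (p + (s o\<^sub>L y)) = norm (s o\<^sub>L (x - y))"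
      by (simp add: dist_norm compose_simps)
    then show "dist (p + (s o\<^sub>L x)) (p + (s o\<^sub>L y)) \<le> norm s * dist x y"
      using norm_blinfun_compose[of s "x - y"] by (simp add: dist_norm)
  qed
  then show ?thesis
    by blast
qed

text \<open>The equation \<open>e = q - q e\<close> says that \<open>e = q(1 + q)\<inverse>\<close>, equivalently \<open>id - e = (1 + q)\<inverse>\<close>, without
  mentioning inverses.\<close>

lemma ex_resolvent_small_norm:
  assumes A: "operator_algebra A" and q: "q \<in> A" "norm q < 1"
  shows "\<exists>e\<in>A. e = q - (q o\<^sub>L e)"
proof -
  have "\<exists>e\<in>A. q + ((- q) o\<^sub>L e) = e"
  proof (rule ex_left_fixpoint[OF A q(1)])
    fix x assume "x \<in> A"
    then have "0 - (q o\<^sub>L x) \<in> A"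
      by (intro operator_algebra_diff operator_algebra_compose operator_algebra_zero A q)
    then show "(- q) o\<^sub>L x \<in> A"
      by (simp add: bounded_bilinear.minus_left[OF bounded_bilinear_blinfun_compose])
  qed (use q in simp)
  then show ?thesis
    by (simp add: bounded_bilinear.minus_left[OF bounded_bilinear_blinfun_compose]) metis
qed

text \<open>Here \<open>l z\<close> may be large. With \<open>T = id - z\<close> and \<open>r = l/(1 + l) < 1\<close> one has
  \<open>1 + l z = (1 + l)(1 - r T)\<close>, so the equation for \<open>l z\<close> is a fixed point equation with the
  contraction \<open>r T\<close>.\<close>

lemma ex_resolvent_near_id:
  assumes A: "operator_algebra A" and z: "z \<in> A" "norm (id_blinfun - z) \<le> 1" and l: "l > 0"
  shows "\<exists>e\<in>A. e = l *\<^sub>R z - (l *\<^sub>R z o\<^sub>L e)"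
proof -
  define r where "r = l / (1 + l)"
  have r: "0 < r" "r < 1" "(1 + l) * r = l" "(1 + l) * (1 - r) = 1"
    using l by (auto simp: r_def field_simps)
  have "\<exists>e\<in>A. r *\<^sub>R z + ((r *\<^sub>R (id_blinfun - z)) o\<^sub>L e) = e"
  proof (rule ex_left_fixpoint[OF A])
    show "r *\<^sub>R z \<in> A"
      using A z by (simp add: operator_algebra_scaleR)
    have "r * norm (id_blinfun - z) \<le> r * 1"
      using r z by (intro mult_left_mono) auto
    also have "\<dots> < 1"
      using r by simp
    finally show "norm (r *\<^sub>R (id_blinfun - z)) < 1"
      using r by simp
    show "r *\<^sub>R (id_blinfun - z) o\<^sub>L x \<in> A" if "x \<in> A" for x
      using that A z
      by (auto simp: compose_simps intro!: operator_algebra_scaleR operator_algebra_diff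
          operator_algebra_compose)
  qed
  then obtain e where e: "e \<in> A" "r *\<^sub>R z + ((r *\<^sub>R (id_blinfun - z)) o\<^sub>L e) = e"
    by blast
  have "(1 - r) *\<^sub>R e = r *\<^sub>R z - (r *\<^sub>R z o\<^sub>L e)"
    using e(2) by (simp add: compose_simps algebra_simps)
  then have "(1 + l) *\<^sub>R ((1 - r) *\<^sub>R e) = (1 + l) *\<^sub>R (r *\<^sub>R z - (r *\<^sub>R z o\<^sub>L e))"
    by simp
  then have "e = l *\<^sub>R z - (l *\<^sub>R z o\<^sub>L e)"
    unfolding scaleR_diff_right compose_simps scaleR_scaleR r by simp
  then show ?thesis
    using e(1) by blast
qed

text \<open>With \<open>w = (1 + q)\<inverse> v\<close> we have \<open>v = w + q w\<close>, and accretivity makes the cross term in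
  \<open>\<parallel>w + q w\<parallel>\<^sup>2\<close> nonnegative. So \<open>\<parallel>w\<parallel>\<^sup>2 + \<parallel>q w\<parallel>\<^sup>2 \<le> \<parallel>v\<parallel>\<^sup>2\<close>, which bounds \<open>id - e\<close> and \<open>e\<close> at once.\<close>

lemma resolvent_bounds:
  assumes q: "accretive q" and e: "e = q - (q o\<^sub>L e)"
  shows "norm e \<le> 1" "norm (id_blinfun - e) \<le> 1"
proof -
  have b: "(norm (v - e v))\<^sup>2 + (norm (e v))\<^sup>2 \<le> (norm v)\<^sup>2" for v
  proof -
    define w where "w = v - e v"
    have "q w = (q - (q o\<^sub>L e)) v"
      by (simp add: w_def blinfun.diff_right blinfun.diff_left)
    then have qw: "q w = e v"
      by (simp only: e[symmetric])
    have "(norm v)\<^sup>2 = (norm (w + 1 *\<^sub>R q w))\<^sup>2"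
      unfolding qw by (simp add: w_def)
    also have "\<dots> = (norm w)\<^sup>2 + 2 * rinner (q w) w + (norm (q w))\<^sup>2"
      unfolding norm_add_scaleR_sq by (simp add: rinner_commute)
    finally have "(norm v)\<^sup>2 = (norm w)\<^sup>2 + 2 * rinner (q w) w + (norm (q w))\<^sup>2" .
    moreover have "0 \<le> rinner (q w) w"
      using q by (simp add: re_ge_def)
    ultimately have "(norm w)\<^sup>2 + (norm (q w))\<^sup>2 \<le> (norm v)\<^sup>2"
      by linarith
    then show ?thesis
      unfolding qw by (simp add: w_def)
  qed
  have sq: "(norm (e v))\<^sup>2 \<le> (norm v)\<^sup>2" "(norm (v - e v))\<^sup>2 \<le> (norm v)\<^sup>2" for v
    using b[of v] zero_le_power2[of "norm (e v)"] zero_le_power2[of "norm (v - e v)"]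
    by linarith+
  have "norm (e v) \<le> norm v" "norm (v - e v) \<le> norm v" for v
    by (rule power2_le_imp_le[OF sq(1)] power2_le_imp_le[OF sq(2)], simp)+
  then show "norm e \<le> 1" "norm (id_blinfun - e) \<le> 1"
    by (auto intro!: norm_blinfun_bound simp: blinfun.diff_left)
qed

section \<open>Approximate units from resolvents\<close>

text \<open>Let \<open>R = id - e = (1 + l z)\<inverse>\<close>; both claims bound a product of \<open>R\<close> and \<open>x\<close>, using for
  \<open>w = R v\<close> that \<open>Re \<langle>v, w\<rangle> = \<parallel>w\<parallel>\<^sup>2 + l Re \<langle>z w, w\<rangle>\<close>. On the right,
  \<open>\<parallel>x R v\<parallel>\<^sup>2 \<le> 2 Re \<langle>x w, w\<rangle> \<le> 2N Re \<langle>z w, w\<rangle> \<le> (2N/l) \<parallel>v\<parallel>\<^sup>2\<close>. On the left, \<open>w = R x v\<close>, and the bound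
  on \<open>Re \<langle>x v, w\<rangle>\<close> by \<open>Re \<langle>x w, w\<rangle> \<le> N Re \<langle>z w, w\<rangle>\<close> is absorbed by the term \<open>l Re \<langle>z w, w\<rangle>\<close>.\<close>

lemma resolvent_approximates:
  fixes x z e :: "'h::chilbert_space op"
  assumes x: "norm (id_blinfun - x) \<le> 1"
    and xz: "\<And>v. rinner (x v) v \<le> N * rinner (z v) v" and N: "N > 0" and z: "accretive z"
    and l: "l > 0" and e: "e = l *\<^sub>R z - (l *\<^sub>R z o\<^sub>L e)" and d: "d > 0" "2 * N \<le> l * d\<^sup>2"
  shows "norm ((x o\<^sub>L e) - x) \<le> d" "norm ((e o\<^sub>L x) - x) \<le> d"
proof -
  have res: "v = (v - e v) + l *\<^sub>R z (v - e v)" for v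
  proof -
    have "l *\<^sub>R z (v - e v) = (l *\<^sub>R z - (l *\<^sub>R z o\<^sub>L e)) v"
      by (simp add: blinfun.diff_right blinfun.diff_left blinfun.scaleR_left scaleR_diff_right)
    then have "l *\<^sub>R z (v - e v) = e v"
      by (simp only: e[symmetric])
    then show ?thesis
      by simp
  qed
  have form: "rinner v (v - e v) = (norm (v - e v))\<^sup>2 + l * rinner (z (v - e v)) (v - e v)" for v
    by (subst (1) res[of v]) (simp add: rinner.add_left rinner.scaleR_left rinner_self)
  have "norm (((x o\<^sub>L e) - x) v) \<le> d * norm v" for v
  proof -
    define w where "w = v - e v"
    have zw: "0 \<le> rinner (z w) w"
      using z by (simp add: re_ge_def)
    have "accretive (l *\<^sub>R z)"
      using z l by (simp add: re_ge_def blinfun.scaleR_left rinner.scaleR_left)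
    from norm_blinfun_le_oneD[OF resolvent_bounds(2)[OF this e], of v]
    have wv: "norm w \<le> norm v"
      by (simp add: w_def blinfun.diff_left)
    have "rinner v w = (norm w)\<^sup>2 + l * rinner (z w) w"
      unfolding w_def by (rule form)
    then have "l * rinner (z w) w \<le> rinner v w"
      by simp
    also have "\<dots> \<le> norm v * norm w"
      by (rule rinner_le_norm)
    also have "\<dots> \<le> (norm v)\<^sup>2"
      unfolding power2_eq_square using wv by (intro mult_left_mono) auto
    finally have lz: "l * rinner (z w) w \<le> (norm v)\<^sup>2" .
    have "(norm (x w))\<^sup>2 \<le> 2 * rinner (x w) w"
      by (rule two_rinner_ge_norm_sq[OF x])
    also have "\<dots> \<le> (2 * N) * rinner (z w) w"
      using xz[of w] by simp
    also have "\<dots> \<le> (l * d\<^sup>2) * rinner (z w) w"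
      using d zw by (intro mult_right_mono) auto
    also have "\<dots> = d\<^sup>2 * (l * rinner (z w) w)"
      by (simp only: mult_ac)
    also have "\<dots> \<le> d\<^sup>2 * (norm v)\<^sup>2"
      by (intro mult_left_mono lz) simp
    finally have "(norm (x w))\<^sup>2 \<le> (d * norm v)\<^sup>2"
      by (simp add: power_mult_distrib)
    then have "norm (x w) \<le> d * norm v"
      by (rule power2_le_imp_le) (use d in simp)
    then show ?thesis
      by (simp add: w_def blinfun.diff_left blinfun.diff_right norm_minus_commute)
  qed
  then show "norm ((x o\<^sub>L e) - x) \<le> d"
    using d by (intro norm_blinfun_bound) auto
  have "norm (((e o\<^sub>L x) - x) v) \<le> d * norm v" for v
  proof -
    define w where "w = x v - e (x v)"
    have "rinner (x v) w = (norm w)\<^sup>2 + l * rinner (z w) w"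
      unfolding w_def by (rule form)
    then have "2 * (N / l) * rinner (x v) w = 2 * (N / l) * (norm w)\<^sup>2 + 2 * N * rinner (z w) w"
      using l by (simp add: distrib_left)
    (* s = N / l makes the two multiples of rinner (z w) w cancel *)
    moreover have "2 * (N / l) * rinner (x v) w \<le> 2 * rinner (x w) w + (N / l)\<^sup>2 * (norm v)\<^sup>2"
      by (rule two_rinner_le_form_plus_norm_sq[OF x])
    moreover have "2 * rinner (x w) w \<le> 2 * N * rinner (z w) w"
      using xz[of w] by simp
    ultimately have "2 * (N / l) * (norm w)\<^sup>2 \<le> (N / l)\<^sup>2 * (norm v)\<^sup>2"
      by linarith
    then have "(2 * (N / l)) * (norm w)\<^sup>2 \<le> (2 * (N / l)) * (N / (2 * l) * (norm v)\<^sup>2)"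
      by (simp add: power2_eq_square)
    then have "(norm w)\<^sup>2 \<le> N / (2 * l) * (norm v)\<^sup>2"
      using N l by (subst (asm) mult_le_cancel_left_pos) auto
    also have "\<dots> \<le> d\<^sup>2 * (norm v)\<^sup>2"
    proof (rule mult_right_mono)
      show "N / (2 * l) \<le> d\<^sup>2"
        using d N l by (simp add: pos_divide_le_eq mult_ac)
    qed simp
    finally have "(norm w)\<^sup>2 \<le> (d * norm v)\<^sup>2"
      by (simp add: power_mult_distrib)
    then have "norm w \<le> d * norm v"
      by (rule power2_le_imp_le) (use d in simp)
    then show ?thesis
      by (simp add: w_def blinfun.diff_left norm_minus_commute)
  qed
  then show "norm ((e o\<^sub>L x) - x) \<le> d"
    using d by (intro norm_blinfun_bound) auto
qed

text \<open>All forms \<open>Re \<langle>x v, v\<rangle>\<close> with \<open>x \<in> G\<close> are nonnegative, so each is at most their sum, which is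
  \<open>card G\<close> times the form of the average.\<close>

lemma common_approximate_unit:
  fixes A :: "'h::chilbert_space op set"
  assumes A: "operator_algebra A" and G: "finite G" "G \<noteq> {}"
    "G \<subseteq> {x \<in> A. norm (id_blinfun - x) \<le> 1}" and d: "d > 0"
  shows "\<exists>e\<in>A. norm e \<le> 1 \<and> (\<forall>x\<in>G. norm ((e o\<^sub>L x) - x) \<le> d \<and> norm ((x o\<^sub>L e) - x) \<le> d)"
proof -
  define N where "N = real (card G)"
  define z where "z = (1 / N) *\<^sub>R (\<Sum>x\<in>G. x)"
  define l where "l = 2 * N / d\<^sup>2"
  have N: "N > 0"
    using G by (simp add: N_def card_gt_0_iff)
  have l: "l > 0" "2 * N \<le> l * d\<^sup>2"
    using N d by (auto simp: l_def)
  have acc: "0 \<le> rinner (blinfun_apply x v) v" if "x \<in> G" for x v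
  proof -
    have "norm (id_blinfun - x) \<le> 1"
      using that G by auto
    from two_rinner_ge_norm_sq[OF this, of v] show ?thesis
      using zero_le_power2[of "norm (x v)"] by linarith
  qed
  have Nz: "N * rinner (z v) v = (\<Sum>x\<in>G. rinner (blinfun_apply x v) v)" for v
    using N by (simp add: z_def blinfun.scaleR_left rinner.scaleR_left blinfun.sum_left rinner.sum_left)
  have "(\<Sum>x\<in>G. x) \<in> A"
    using G A by (intro op.subspace_sum) (auto simp: operator_algebra_def)
  then have zA: "z \<in> A"
    unfolding z_def using A by (simp add: operator_algebra_scaleR)
  have idz: "id_blinfun - z = (1 / N) *\<^sub>R (\<Sum>x\<in>G. id_blinfun - x)"
    using N by (simp add: z_def sum_subtractf N_def scaleR_diff_right sum_constant_scaleR)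
  have "norm (\<Sum>x\<in>G. id_blinfun - x) \<le> (\<Sum>x\<in>G. 1)"
    using G by (intro order_trans[OF norm_sum] sum_mono) auto
  then have "norm (\<Sum>x\<in>G. id_blinfun - x) / N \<le> 1"
    using N by (simp add: N_def pos_divide_le_eq)
  then have z1: "norm (id_blinfun - z) \<le> 1"
    unfolding idz using N by simp
  have "0 \<le> N * rinner (z v) v" for v
    unfolding Nz using acc by (intro sum_nonneg) auto
  then have zacc: "accretive z"
    using N by (simp add: re_ge_def zero_le_mult_iff)
  obtain e where e: "e \<in> A" "e = l *\<^sub>R z - (l *\<^sub>R z o\<^sub>L e)"
    using ex_resolvent_near_id[OF A zA z1 l(1)] by metis
  have "accretive (l *\<^sub>R z)"
    using zacc l(1) by (simp add: re_ge_def blinfun.scaleR_left rinner.scaleR_left)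
  then have "norm e \<le> 1"
    by (rule resolvent_bounds(1)[OF _ e(2)])
  moreover have "norm ((e o\<^sub>L x) - x) \<le> d \<and> norm ((x o\<^sub>L e) - x) \<le> d" if "x \<in> G" for x
  proof -
    have x: "norm (id_blinfun - x) \<le> 1"
      using that G by auto
    have xz: "rinner (blinfun_apply x v) v \<le> N * rinner (z v) v" for v
      unfolding Nz using that G acc by (intro member_le_sum) auto
    show ?thesis
      using resolvent_approximates[OF x xz N zacc l(1) e(2) d l(2)] by simp
  qed
  ultimately show ?thesis
    using e(1) by blast
qed


lemma bounded_linear_scale_op: "bounded_linear (scale_op c :: 'h::chilbert_space op \<Rightarrow> 'h op)"
proof (rule bounded_linear_intro[where K = "cmod c"])
  fix f g :: "'h op" and r :: real
  show "scale_op c (f + g) = scale_op c f + scale_op c g"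
    by (rule op.scale_right_distrib)
  show "scale_op c (r *\<^sub>R f) = r *\<^sub>R scale_op c f"
    by (rule blinfun_eqI)
      (simp add: scale_op.rep_eq scaleR_blinfun.rep_eq linear_cmul[OF bounded_linear.linear[OF bounded_linear_scaleC]])
  show "norm (scale_op c f) \<le> norm f * cmod c"
  proof (rule norm_blinfun_bound)
    fix v
    have "norm (scale_op c f v) = cmod c * norm (f v)"
      by (simp add: scale_op.rep_eq norm_scaleC)
    also have "\<dots> \<le> cmod c * (norm f * norm v)"
      by (intro mult_left_mono norm_blinfun) auto
    finally show "norm (scale_op c f v) \<le> norm f * cmod c * norm v"
      by (simp add: mult_ac)
  qed simp
qed

lemma closed_contractive_limit:
  fixes L :: "'i \<Rightarrow> 'h::real_normed_vector \<Rightarrow> 'h"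
  assumes lin: "\<And>t x y. L t (x - y) = L t x - L t y"
    and contr: "eventually (\<lambda>t. \<forall>x. norm (L t x) \<le> norm x) F"
  shows "closed {x. ((\<lambda>t. L t x) \<longlongrightarrow> x) F}"
proof -
  have "x \<in> {x. ((\<lambda>t. L t x) \<longlongrightarrow> x) F}" if x: "x \<in> closure {x. ((\<lambda>t. L t x) \<longlongrightarrow> x) F}" for x
    unfolding mem_Collect_eq
  proof (rule tendstoI)
    fix d :: real assume "d > 0"
    then obtain y where y: "((\<lambda>t. L t y) \<longlongrightarrow> y) F" "dist y x < d / 3"
      using x unfolding closure_approachable by (metis mem_Collect_eq zero_less_divide_iff zero_less_numeral)
    have "eventually (\<lambda>t. dist (L t y) y < d / 3) F"
      using y(1) \<open>d > 0\<close> by (intro tendstoD) auto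
    then show "eventually (\<lambda>t. dist (L t x) x < d) F"
      using contr
    proof eventually_elim
      case (elim t)
      have "dist (L t x) (L t y) \<le> dist x y"
        using elim(2) lin[of t x y] by (simp add: dist_norm flip: lin)
      moreover have "dist (L t x) x \<le> dist (L t x) (L t y) + (dist (L t y) y + dist y x)"
        by (metis add_left_mono dist_triangle order_trans)
      ultimately show ?case
        using elim(1) y(2) by (simp add: dist_commute)
    qed
  qed
  then show ?thesis
    unfolding closure_subset_eq[symmetric] by (rule subsetI)
qed

text \<open>The net is indexed by the pairs of a finite subset of \<open>F\<close> and a precision. The elements on
  which it acts as a left or right approximate unit form closed complex subspaces; invariance of the
  left one under complex scalars is where complex linearity of the operators enters.\<close>

lemma has_cai_of_dense_span:
  fixes A :: "'h::chilbert_space op set"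
  assumes A: "operator_algebra A"
    and dense: "A \<subseteq> closure (op.span {x \<in> A. norm (id_blinfun - x) \<le> 1})"
  shows "has_cai A"
proof -
  define F where "F = {x \<in> A. norm (id_blinfun - x) \<le> 1}"
  define I where "I = {(G, n :: nat). finite G \<and> G \<noteq> {} \<and> G \<subseteq> F}"
  define le where "le = (\<lambda>(p :: 'h op set \<times> nat) q. fst p \<subseteq> fst q \<and> snd p \<le> snd q)"
  have "norm (id_blinfun :: 'h op) \<le> 1"
    by (rule norm_blinfun_bound) auto
  then have F0: "0 \<in> F"
    using operator_algebra_zero[OF A] by (simp add: F_def)
  have dir: "directed_set I le"
    unfolding directed_set_def
  proof (intro conjI ballI)
    show "I \<noteq> {}"
      using F0 by (auto simp: I_def intro!: exI[of _ "{0}"])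
    fix p q assume "p \<in> I" "q \<in> I"
    then show "\<exists>k\<in>I. le p k \<and> le q k"
      by (intro bexI[of _ "(fst p \<union> fst q, max (snd p) (snd q))"]) (auto simp: I_def le_def)
  qed (auto simp: le_def)
  define P where "P p f \<longleftrightarrow> f \<in> A \<and> norm f \<le> 1 \<and> (\<forall>x\<in>fst p.
      norm ((f o\<^sub>L x) - x) \<le> inverse (real (Suc (snd p))) \<and>
      norm ((x o\<^sub>L f) - x) \<le> inverse (real (Suc (snd p))))" for p :: "'h op set \<times> nat" and f
  have "\<exists>f. P p f" if "p \<in> I" for p
  proof -
    have "finite (fst p)" "fst p \<noteq> {}" "fst p \<subseteq> {x \<in> A. norm (id_blinfun - x) \<le> 1}"
      "inverse (real (Suc (snd p))) > 0"
      using that by (auto simp: I_def F_def)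
    from common_approximate_unit[OF A this] show ?thesis
      unfolding P_def Bex_def .
  qed
  then obtain e where "\<forall>p\<in>I. P p (e p)"
    by metis
  then have e: "e p \<in> A \<and> norm (e p) \<le> 1 \<and> (\<forall>x\<in>fst p.
      norm ((e p o\<^sub>L x) - x) \<le> inverse (real (Suc (snd p))) \<and>
      norm ((x o\<^sub>L e p) - x) \<le> inverse (real (Suc (snd p))))" if "p \<in> I" for p
    using that unfolding P_def by blast
  let ?T = "tail_filter I le"
  have ev_I: "eventually (\<lambda>t. e t \<in> A \<and> norm (e t) \<le> 1) ?T"
  proof -
    obtain i where "i \<in> I"
      using dir unfolding directed_set_def by blast
    then show ?thesis
      unfolding eventually_tail_filter[OF dir] using e by (intro bexI[of _ i]) simp_all
  qed
  define L where "L = {x :: 'h op. ((\<lambda>t. e t o\<^sub>L x) \<longlongrightarrow> x) ?T}"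
  define R where "R = {x :: 'h op. ((\<lambda>t. x o\<^sub>L e t) \<longlongrightarrow> x) ?T}"
  have "F \<subseteq> L \<inter> R"
  proof
    fix x assume x: "x \<in> F"
    have small: "eventually (\<lambda>t. norm ((e t o\<^sub>L x) - x) < d \<and> norm ((x o\<^sub>L e t) - x) < d) ?T"
      if d: "d > 0" for d
    proof -
      obtain n where n: "inverse (real (Suc n)) < d"
        using reals_Archimedean[OF d] by blast
      have "norm ((e q o\<^sub>L x) - x) < d \<and> norm ((x o\<^sub>L e q) - x) < d"
        if q: "q \<in> I" "le ({x}, n) q" for q
      proof -
        have "inverse (real (Suc (snd q))) \<le> inverse (real (Suc n))"
          using q by (auto simp: le_def)
        moreover have "x \<in> fst q"
          using q by (auto simp: le_def)
        then have "norm ((e q o\<^sub>L x) - x) \<le> inverse (real (Suc (snd q)))"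
          "norm ((x o\<^sub>L e q) - x) \<le> inverse (real (Suc (snd q)))"
          using e[OF q(1)] by blast+
        ultimately show ?thesis
          using n by linarith
      qed
      then show ?thesis
        unfolding eventually_tail_filter[OF dir] using x
        by (intro bexI[of _ "({x}, n)"]) (auto simp: I_def)
    qed
    show "x \<in> L \<inter> R"
      unfolding L_def R_def tendsto_iff dist_norm
      using small by (simp add: eventually_conj_iff)
  qed
  have sub_L: "op.subspace L"
  proof (rule op.subspaceI)
    show "0 \<in> L"
      by (simp add: L_def)
    show "x + y \<in> L" if "x \<in> L" "y \<in> L" for x y
      using that by (auto simp: L_def compose_simps intro: tendsto_add)
    show "scale_op c x \<in> L" if "x \<in> L" for c x
    proof -
      have "((\<lambda>t. scale_op c (e t o\<^sub>L x)) \<longlongrightarrow> scale_op c x) ?T"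
        using that by (auto simp: L_def intro: bounded_linear.tendsto[OF bounded_linear_scale_op])
      moreover have "eventually (\<lambda>t. scale_op c (e t o\<^sub>L x) = e t o\<^sub>L scale_op c x) ?T"
        using ev_I
      proof eventually_elim
        case (elim t)
        then have "complex_linear (e t)"
          using A by (simp add: operator_algebra_def)
        then show ?case
          by (intro blinfun_eqI) (simp add: complex_linear_def scale_op.rep_eq)
      qed
      ultimately show ?thesis
        unfolding L_def by (auto dest: tendsto_cong)
    qed
  qed
  have sub_R: "op.subspace R"
  proof (rule op.subspaceI)
    show "0 \<in> R"
      by (simp add: R_def)
    show "x + y \<in> R" if "x \<in> R" "y \<in> R" for x y
      using that by (auto simp: R_def compose_simps intro: tendsto_add)
    show "scale_op c x \<in> R" if "x \<in> R" for c x
    proof -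
      have "((\<lambda>t. scale_op c (x o\<^sub>L e t)) \<longlongrightarrow> scale_op c x) ?T"
        using that by (auto simp: R_def intro: bounded_linear.tendsto[OF bounded_linear_scale_op])
      moreover have "scale_op c (x o\<^sub>L e t) = scale_op c x o\<^sub>L e t" for t
        by (intro blinfun_eqI) (simp add: scale_op.rep_eq)
      ultimately show ?thesis
        unfolding R_def by simp
    qed
  qed
  have "closed L"
    unfolding L_def
  proof (rule closed_contractive_limit)
    show "\<forall>\<^sub>F t in ?T. \<forall>x. norm (e t o\<^sub>L x) \<le> norm x"
      using ev_I
    proof eventually_elim
      case (elim t)
      then show ?case
        by (metis mult_left_le_one_le norm_blinfun_compose norm_ge_zero order_trans)
    qed
  qed (simp add: compose_simps)
  moreover have "closed R"
    unfolding R_def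
  proof (rule closed_contractive_limit)
    show "\<forall>\<^sub>F t in ?T. \<forall>x. norm (x o\<^sub>L e t) \<le> norm x"
      using ev_I
    proof eventually_elim
      case (elim t)
      then show ?case
        by (metis mult_right_le_one_le norm_blinfun_compose norm_ge_zero order_trans)
    qed
  qed (simp add: compose_simps)
  ultimately have "closure (op.span F) \<subseteq> L \<inter> R"
    using \<open>F \<subseteq> L \<inter> R\<close> sub_L sub_R
    by (intro closure_minimal closed_Int Int_greatest op.span_minimal) auto
  then have "is_cai A I le e"
    unfolding is_cai_def using dir e dense by (auto simp: F_def L_def R_def)
  then show ?thesis
    by (rule is_cai_imp_has_cai)
qed



section \<open>Accretive elements in the closed span\<close>

text \<open>The element \<open>e = c w(1 + c w)\<inverse>\<close> satisfies \<open>\<parallel>id - e\<parallel> \<le> 1\<close> and \<open>e/c = w - w e\<close> with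
  \<open>\<parallel>e\<parallel> = O(c)\<close>.\<close>

lemma accretive_in_closure_span:
  assumes A: "operator_algebra A" and w: "w \<in> A" "accretive w"
  shows "w \<in> closure (op.span {x \<in> A. norm (id_blinfun - x) \<le> 1})" (is "_ \<in> closure ?S")
  unfolding closure_approachable
proof (intro allI impI)
  fix d :: real assume d: "d > 0"
  define M where "M = norm w + 1"
  define c where "c = min (1 / (2 * M)) (d / (4 * M\<^sup>2))"
  have M: "M > 0" "norm w < M"
    by (auto simp: M_def add_nonneg_pos)
  have c: "c > 0" "c * M \<le> 1 / 2" "c * M\<^sup>2 \<le> d / 4"
    using M d by (auto simp: c_def min_def field_simps power2_eq_square)
  have "c * norm w \<le> c * M"
    using M c by (intro mult_left_mono) auto
  moreover have "norm (c *\<^sub>R w) = c * norm w"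
    using c by simp
  ultimately have cw: "norm (c *\<^sub>R w) \<le> 1 / 2"
    using c by linarith
  then have "norm (c *\<^sub>R w) < 1"
    by linarith
  then obtain e where e: "e \<in> A" "e = c *\<^sub>R w - (c *\<^sub>R w o\<^sub>L e)"
    using ex_resolvent_small_norm[OF A operator_algebra_scaleR[OF A w(1)]] by metis
  have "accretive (c *\<^sub>R w)"
    using w(2) c(1) by (simp add: re_ge_def blinfun.scaleR_left rinner.scaleR_left)
  then have "norm (id_blinfun - e) \<le> 1"
    by (rule resolvent_bounds(2)[OF _ e(2)])
  then have eF: "e \<in> op.span {x \<in> A. norm (id_blinfun - x) \<le> 1}"
    using e(1) by (intro op.span_base) simp
  have "(1 / c) *\<^sub>R e \<in> ?S"
    unfolding scale_op_of_real[symmetric] by (rule op.span_scale[OF eF])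
  moreover have "dist ((1 / c) *\<^sub>R e) w < d"
  proof -
    have "norm (c *\<^sub>R w o\<^sub>L e) \<le> norm (c *\<^sub>R w) * norm e"
      by (rule norm_blinfun_compose)
    also have "\<dots> \<le> 1 / 2 * norm e"
      using cw by (intro mult_right_mono) auto
    finally have "norm e \<le> norm (c *\<^sub>R w) + 1 / 2 * norm e"
      using arg_cong[OF e(2), of norm] norm_triangle_ineq4[of "c *\<^sub>R w" "c *\<^sub>R w o\<^sub>L e"]
      by linarith
    then have ne: "norm e \<le> 2 * (c * norm w)"
      using c by simp
    have ce: "e = c *\<^sub>R (w - (w o\<^sub>L e))"
      by (subst (1) e(2)) (simp add: compose_simps scaleR_diff_right)
    have ec: "(1 / c) *\<^sub>R e = w - (w o\<^sub>L e)"
      using c(1) by (subst (1) ce) simp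
    have "(1 / c) *\<^sub>R e - w = - (w o\<^sub>L e)"
      by (simp only: ec) simp
    then have "dist ((1 / c) *\<^sub>R e) w = norm (w o\<^sub>L e)"
      by (simp only: dist_norm norm_minus_cancel)
    also have "\<dots> \<le> norm w * norm e"
      by (rule norm_blinfun_compose)
    also have "\<dots> \<le> M * (2 * (c * M))"
      using ne M c by (intro mult_mono order_trans[OF ne]) auto
    also have "\<dots> = 2 * (c * M\<^sup>2)"
      by (simp add: power2_eq_square)
    also have "\<dots> < d"
      using c d by simp
    finally show ?thesis .
  qed
  ultimately show "\<exists>y\<in>?S. dist y w < d"
    by blast
qed

section \<open>Almost positive elements from an approximate identity\<close>

text \<open>If \<open>e\<close> is a contraction and \<open>e p = p\<close>, then \<open>e\<^sup>* p = p\<close>, that is, \<open>\<langle>w - e w, p\<rangle> = 0\<close>: compare the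
  first order terms of \<open>\<parallel>e (p + s w)\<parallel>\<^sup>2 \<le> \<parallel>p + s w\<parallel>\<^sup>2\<close> in \<open>s\<close>. If \<open>e p\<close> differs from \<open>p\<close> by \<open>t\<^sup>2\<close>,
  the choice \<open>s = \<plusminus>t\<close> balances the errors and leaves \<open>O(t)\<close>. The number \<open>m\<close> is a common scale for
  \<open>p\<close> and \<open>w\<close>.\<close>

lemma almost_fixed_imp_adjoint_almost_fixed:
  assumes e: "norm e \<le> 1" and t: "0 < t" "t \<le> 1" and K: "K \<ge> 0"
    and p: "norm p \<le> K * m" "norm (p - blinfun_apply e p) \<le> t\<^sup>2 * m" and w: "norm w \<le> m"
  shows "\<bar>rinner (w - blinfun_apply e w) p\<bar> \<le> (K + 2) * t * m\<^sup>2"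
proof -
  have m: "m \<ge> 0"
    using w norm_ge_zero order_trans by blast
  have ew: "norm (e w) \<le> m"
    using norm_blinfun_le_oneD[OF e] w order_trans by blast
  have "(norm p)\<^sup>2 - (norm (e p))\<^sup>2 = (norm p - norm (e p)) * (norm p + norm (e p))"
    by (simp add: power2_eq_square algebra_simps)
  also have "\<dots> \<le> (t\<^sup>2 * m) * (K * m + K * m)"
  proof (rule mult_mono)
    show "norm p - norm (e p) \<le> t\<^sup>2 * m"
      using norm_triangle_ineq2[of p "e p"] p(2) by linarith
    show "norm p + norm (e p) \<le> K * m + K * m"
      using norm_blinfun_le_oneD[OF e, of p] p(1) by linarith
  qed (use m in auto)
  also have "\<dots> = 2 * K * t\<^sup>2 * m\<^sup>2"
    by (simp add: power2_eq_square)
  finally have np: "(norm p)\<^sup>2 - (norm (e p))\<^sup>2 \<le> 2 * K * t\<^sup>2 * m\<^sup>2" .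
  have bound: "2 * s * (rinner (e w) p - rinner w p) \<le> 2 * t * ((K + 2) * t * m\<^sup>2)"
    if s: "\<bar>s\<bar> = t" for s
  proof -
    have "norm (e (p + s *\<^sub>R w)) \<le> norm (p + s *\<^sub>R w)"
      by (rule norm_blinfun_le_oneD[OF e])
    then have "(norm (e p + s *\<^sub>R e w))\<^sup>2 \<le> (norm (p + s *\<^sub>R w))\<^sup>2"
      by (simp add: blinfun.add_right blinfun.scaleR_right power_mono)
    then have 1: "(norm (e p))\<^sup>2 + 2 * s * rinner (e p) (e w) + s\<^sup>2 * (norm (e w))\<^sup>2
        \<le> (norm p)\<^sup>2 + 2 * s * rinner p w + s\<^sup>2 * (norm w)\<^sup>2"
      unfolding norm_add_scaleR_sq .
    have "\<bar>s * rinner (p - e p) (e w)\<bar> \<le> t * ((t\<^sup>2 * m) * m)"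
      unfolding abs_mult s using t m
      by (intro mult_left_mono order_trans[OF abs_rinner_le] mult_mono p(2) ew) auto
    also have "\<dots> = t\<^sup>2 * m\<^sup>2 * t"
      by (simp add: power2_eq_square)
    also have "\<dots> \<le> t\<^sup>2 * m\<^sup>2 * 1"
      using t by (intro mult_left_mono) auto
    finally have 2: "s * rinner (p - e p) (e w) \<le> t\<^sup>2 * m\<^sup>2"
      by simp
    have "s\<^sup>2 * (norm w)\<^sup>2 \<le> t\<^sup>2 * m\<^sup>2"
      unfolding power2_abs[of s, symmetric] s using w by (intro mult_left_mono power_mono) auto
    then have 3: "s\<^sup>2 * (norm w)\<^sup>2 - s\<^sup>2 * (norm (e w))\<^sup>2 \<le> t\<^sup>2 * m\<^sup>2"
      using zero_le_power2[of "s * norm (e w)"] unfolding power_mult_distrib by linarith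
    have "2 * s * (rinner (e w) p - rinner w p)
        = 2 * s * rinner (e p) (e w) - 2 * s * rinner p w + 2 * (s * rinner (p - e p) (e w))"
      by (simp add: rinner.diff_left rinner_commute[of "e w" p] rinner_commute[of w p] algebra_simps)
    also have "\<dots> \<le> 2 * K * t\<^sup>2 * m\<^sup>2 + t\<^sup>2 * m\<^sup>2 + 2 * (t\<^sup>2 * m\<^sup>2)"
      using 1 2 3 np by linarith
    also have "\<dots> \<le> 2 * K * t\<^sup>2 * m\<^sup>2 + 4 * (t\<^sup>2 * m\<^sup>2)"
      using zero_le_power2[of "t * m"] unfolding power_mult_distrib by linarith
    also have "\<dots> = 2 * t * ((K + 2) * t * m\<^sup>2)"
      by (simp add: algebra_simps power2_eq_square)
    finally show ?thesis .
  qed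
  have "\<bar>2 * t * (rinner (e w) p - rinner w p)\<bar> \<le> 2 * t * ((K + 2) * t * m\<^sup>2)"
    using bound[of t] bound[of "- t"] t(1) by (intro abs_leI) (simp_all only: abs_minus_cancel abs_of_pos mult_minus_left mult_minus_right)
  then have "2 * t * \<bar>rinner (e w) p - rinner w p\<bar> \<le> 2 * t * ((K + 2) * t * m\<^sup>2)"
    using t(1) by (simp only: abs_mult abs_of_pos abs_numeral)
  then have "\<bar>rinner (e w) p - rinner w p\<bar> \<le> (K + 2) * t * m\<^sup>2"
    using t by (subst (asm) mult_le_cancel_left_pos) auto
  then show ?thesis
    by (simp add: rinner.diff_left abs_minus_commute)
qed

text \<open>A contractive approximate identity as a filter on the operators themselves, the form in which
  finitely many approximation conditions can be met by one element.\<close>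

definition cai_filter :: "'h::chilbert_space op set \<Rightarrow> 'h op filter \<Rightarrow> bool" where
  "cai_filter A F \<longleftrightarrow> F \<noteq> bot \<and> eventually (\<lambda>f. f \<in> A \<and> norm f \<le> 1) F \<and>
    (\<forall>x\<in>A. ((\<lambda>f. f o\<^sub>L x) \<longlongrightarrow> x) F \<and> ((\<lambda>f. x o\<^sub>L f) \<longlongrightarrow> x) F)"

text \<open>The bound on \<open>\<langle>w - e w, f v\<rangle>\<close>, uniform in \<open>v\<close> and \<open>w\<close>, states that \<open>e\<^sup>* f\<close> is close to \<open>f\<close>.\<close>

lemma eventually_almost_identity:
  fixes A :: "'h::chilbert_space op set"
  assumes F: "cai_filter A F" and f: "f \<in> A" and \<eta>: "\<eta> > 0"
  shows "eventually (\<lambda>e. norm ((f o\<^sub>L e) - f) \<le> \<eta> \<and>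
    (\<forall>v w. \<bar>rinner (w - e w) (f v)\<bar> \<le> \<eta> * norm w * norm v)) F"
proof -
  define t where "t = min 1 (\<eta> / (norm f + 2))"
  have f2: "norm f + 2 > 0"
    by (simp add: add_nonneg_pos)
  have "\<eta> / (norm f + 2) > 0"
    using \<eta> f2 by (rule divide_pos_pos)
  then have t: "0 < t" "t \<le> 1"
    by (auto simp: t_def)
  have "t * (norm f + 2) \<le> \<eta> / (norm f + 2) * (norm f + 2)"
    using f2 by (intro mult_right_mono) (auto simp: t_def)
  then have t\<eta>: "(norm f + 2) * t \<le> \<eta>"
    using f2 by (simp add: mult.commute)
  have "eventually (\<lambda>e. dist (e o\<^sub>L f) f < t\<^sup>2) F" "eventually (\<lambda>e. dist (f o\<^sub>L e) f < \<eta>) F"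
    using F f t \<eta> unfolding cai_filter_def by (auto intro: tendstoD)
  moreover have "eventually (\<lambda>f. f \<in> A \<and> norm f \<le> 1) F"
    using F by (simp add: cai_filter_def)
  ultimately show ?thesis
  proof eventually_elim
    case (elim e)
    have "\<bar>rinner (w - e w) (f v)\<bar> \<le> \<eta> * norm w * norm v" for v w
    proof -
      define m where "m = norm w * norm v"
      have m: "m \<ge> 0"
        by (simp add: m_def)
      (* rescaling gives both arguments the size m, up to the factor norm f *)
      have "\<bar>rinner (norm v *\<^sub>R w - e (norm v *\<^sub>R w)) (norm w *\<^sub>R f v)\<bar> \<le> (norm f + 2) * t * m\<^sup>2"
      proof (rule almost_fixed_imp_adjoint_almost_fixed)
        show "norm (norm w *\<^sub>R f v) \<le> norm f * m"
          using mult_left_mono[OF norm_blinfun[of f v], of "norm w"] by (simp add: m_def mult_ac)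
        have "norm ((f - (e o\<^sub>L f)) v) \<le> norm (f - (e o\<^sub>L f)) * norm v"
          by (rule norm_blinfun)
        also have "\<dots> \<le> t\<^sup>2 * norm v"
          using elim(1) by (intro mult_right_mono) (auto simp: dist_norm norm_minus_commute)
        finally have "norm w * norm (f v - e (f v)) \<le> norm w * (t\<^sup>2 * norm v)"
          by (intro mult_left_mono) (auto simp: blinfun.diff_left)
        moreover have "norm (norm w *\<^sub>R f v - e (norm w *\<^sub>R f v)) = norm w * norm (f v - e (f v))"
          by (simp add: blinfun.scaleR_right flip: scaleR_diff_right)
        ultimately show "norm (norm w *\<^sub>R f v - e (norm w *\<^sub>R f v)) \<le> t\<^sup>2 * m"
          by (simp add: m_def mult_ac)
      qed (use elim t in \<open>auto simp: m_def\<close>)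
      also have "\<dots> \<le> \<eta> * m\<^sup>2"
        using t\<eta> by (intro mult_right_mono) auto
      also have "norm v *\<^sub>R w - e (norm v *\<^sub>R w) = norm v *\<^sub>R (w - e w)"
        by (simp add: blinfun.scaleR_right scaleR_diff_right)
      finally have "m * \<bar>rinner (w - e w) (f v)\<bar> \<le> m * (\<eta> * m)"
        by (simp add: rinner.scaleR_left rinner.scaleR_right abs_mult m_def power2_eq_square mult_ac)
      moreover have "\<bar>rinner (w - e w) (f v)\<bar> = 0" if "m = 0"
      proof -
        have "w = 0 \<or> v = 0"
          using that by (simp add: m_def)
        then show ?thesis
          by (auto simp: rinner.zero_left rinner.zero_right)
      qed
      ultimately have "\<bar>rinner (w - e w) (f v)\<bar> \<le> \<eta> * m"
        using m by (cases "m = 0") (simp_all add: mult_le_cancel_left_pos)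
      then show ?thesis
        by (simp add: m_def mult_ac)
    qed
    then show ?case
      using elim(2) by (simp add: dist_norm)
  qed
qed

text \<open>In the induction step the next element \<open>e\<close> of the approximate identity is added to \<open>u\<close>, and the
  old \<open>u\<close> is added to \<open>Y\<close>; thus \<open>u = \<Sum>\<^sub>k e\<^sub>k\<close> and \<open>Y = \<Sum>\<^sub>j\<^sub><\<^sub>k e\<^sub>j\<close>. Only the sum \<open>u\<close> has to be almost
  fixed by \<open>e\<close>: the cross term in \<open>\<parallel>u v + e v\<parallel>\<^sup>2\<close> is then almost \<open>2 Re \<langle>u v, v\<rangle>\<close>, the increment
  of \<open>2 Re \<langle>Y v, v\<rangle>\<close>. The last two claims say that \<open>x u\<close> and \<open>u\<^sup>* x\<close> are close to \<open>n x\<close>.\<close>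

lemma ex_sum_of_almost_units:
  fixes A :: "'h::chilbert_space op set"
  assumes A: "operator_algebra A" and F: "cai_filter A F" and x: "x \<in> A" and \<eta>: "\<eta> > 0"
  shows "\<exists>(u :: 'h op)\<in>A. \<exists>(Y :: 'h op)\<in>A. norm u \<le> real n \<and> 2 * norm Y \<le> (real n)\<^sup>2 \<and>
    (\<forall>v. (norm (blinfun_apply u v))\<^sup>2 \<le> real n * (1 + \<eta>) * (norm v)\<^sup>2 + 2 * rinner (blinfun_apply Y v) v) \<and>
    norm ((x o\<^sub>L u) - real n *\<^sub>R x) \<le> real n * \<eta> \<and>
    (\<forall>v w. \<bar>rinner (real n *\<^sub>R w - blinfun_apply u w) (blinfun_apply x v)\<bar> \<le> real n * \<eta> * norm w * norm v)"
proof (induction n)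
  case 0
  show ?case
    using operator_algebra_zero[OF A]
    by (intro bexI[of _ 0]) (auto simp: rinner.zero_left blinfun.zero_left)
next
  case (Suc n)
  then obtain u Y where u: "u \<in> A" "Y \<in> A" "norm u \<le> real n" "2 * norm Y \<le> (real n)\<^sup>2"
    and uY: "\<And>v. (norm (blinfun_apply u v))\<^sup>2 \<le> real n * (1 + \<eta>) * (norm v)\<^sup>2 + 2 * rinner (blinfun_apply Y v) v"
    and xu: "norm ((x o\<^sub>L u) - real n *\<^sub>R x) \<le> real n * \<eta>"
    and ux: "\<And>v w. \<bar>rinner (real n *\<^sub>R w - blinfun_apply u w) (blinfun_apply x v)\<bar> \<le> real n * \<eta> * norm w * norm v"
    by blast
  have F': "F \<noteq> bot" "eventually (\<lambda>f. f \<in> A \<and> norm f \<le> 1) F"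
    using F by (simp_all add: cai_filter_def)
  have "\<eta> / 2 > 0"
    using \<eta> by simp
  from eventually_happens'[OF F'(1) eventually_conj[OF F'(2) eventually_conj[OF
      eventually_almost_identity[OF F x \<eta>] eventually_almost_identity[OF F u(1) this]]]]
  obtain e where e: "e \<in> A" "norm e \<le> 1" "norm ((x o\<^sub>L e) - x) \<le> \<eta>"
    and ex: "\<And>v w. \<bar>rinner (w - blinfun_apply e w) (x v)\<bar> \<le> \<eta> * norm w * norm v"
    and eu: "\<And>v w. \<bar>rinner (w - blinfun_apply e w) (u v)\<bar> \<le> \<eta> / 2 * norm w * norm v"
    by blast
  have "norm (u + e) \<le> real (Suc n)"
    using norm_triangle_ineq[of u e] u(3) e(2) by simp
  moreover have "2 * norm (Y + u) \<le> (real (Suc n))\<^sup>2"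
    using norm_triangle_ineq[of Y u] u(3,4) by (simp add: power2_eq_square algebra_simps)
  moreover have "(norm ((u + e) v))\<^sup>2
      \<le> real (Suc n) * (1 + \<eta>) * (norm v)\<^sup>2 + 2 * rinner ((Y + u) v) v" for v
  proof -
    have "(norm ((u + e) v))\<^sup>2 = (norm (u v + 1 *\<^sub>R e v))\<^sup>2"
      by (simp add: blinfun.add_left)
    also have "\<dots> = (norm (u v))\<^sup>2 + 2 * rinner (u v) (e v) + (norm (e v))\<^sup>2"
      unfolding norm_add_scaleR_sq by simp
    finally have 1: "(norm ((u + e) v))\<^sup>2 = (norm (u v))\<^sup>2 + 2 * rinner (u v) (e v) + (norm (e v))\<^sup>2" .
    have "rinner (v - e v) (u v) = rinner (u v) v - rinner (u v) (e v)"
      by (simp add: rinner.diff_left rinner.diff_right rinner_commute[of _ "u v"])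
    then have 2: "2 * rinner (u v) (e v) \<le> 2 * rinner (u v) v + \<eta> * (norm v)\<^sup>2"
      using eu[of v v] unfolding power2_eq_square mult.assoc by linarith
    have 3: "(norm (e v))\<^sup>2 \<le> (norm v)\<^sup>2"
      by (intro power_mono norm_blinfun_le_oneD e) simp
    have "real (Suc n) * (1 + \<eta>) * (norm v)\<^sup>2 = real n * (1 + \<eta>) * (norm v)\<^sup>2 + (norm v)\<^sup>2 + \<eta> * (norm v)\<^sup>2"
      by (simp add: algebra_simps)
    moreover have "2 * rinner ((Y + u) v) v = 2 * rinner (Y v) v + 2 * rinner (u v) v"
      by (simp add: blinfun.add_left rinner.add_left)
    ultimately show ?thesis
      using 1 2 3 uY[of v] by linarith
  qed
  moreover have "norm ((x o\<^sub>L (u + e)) - real (Suc n) *\<^sub>R x) \<le> real (Suc n) * \<eta>"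
  proof -
    have "(x o\<^sub>L (u + e)) - real (Suc n) *\<^sub>R x = ((x o\<^sub>L u) - real n *\<^sub>R x) + ((x o\<^sub>L e) - x)"
      by (simp add: compose_simps scaleR_add_left)
    then show ?thesis
      using norm_triangle_ineq[of "(x o\<^sub>L u) - real n *\<^sub>R x" "(x o\<^sub>L e) - x"] xu e(3)
      by (simp add: algebra_simps)
  qed
  moreover have "\<bar>rinner (real (Suc n) *\<^sub>R w - (u + e) w) (x v)\<bar> \<le> real (Suc n) * \<eta> * norm w * norm v"
    for v w
  proof -
    have "real (Suc n) *\<^sub>R w - (u + e) w = (real n *\<^sub>R w - u w) + (w - e w)"
      by (simp add: blinfun.add_left scaleR_add_left)
    then have "rinner (real (Suc n) *\<^sub>R w - (u + e) w) (x v)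
        = rinner (real n *\<^sub>R w - u w) (x v) + rinner (w - e w) (x v)"
      by (simp only: rinner.add_left)
    moreover have "real (Suc n) * \<eta> * norm w * norm v
        = real n * \<eta> * norm w * norm v + \<eta> * norm w * norm v"
      by (simp add: algebra_simps)
    ultimately show ?thesis
      using ux[of w v] ex[of w v] by linarith
  qed
  ultimately show ?case
    using operator_algebra_add[OF A u(1) e(1)] operator_algebra_add[OF A u(2) u(1)] by blast
qed


text \<open>With \<open>u\<close> and \<open>Y\<close> as above, \<open>n\<^sup>2 Re \<langle>x v, v\<rangle> \<approx> Re \<langle>x u v, u v\<rangle> \<ge> -\<epsilon> \<parallel>u v\<parallel>\<^sup>2\<close>. The summand
  \<open>\<epsilon>y\<close> with \<open>y = 2Y/n\<^sup>2\<close> contributes at least \<open>\<epsilon> \<parallel>u v\<parallel>\<^sup>2 - O(n) \<parallel>v\<parallel>\<^sup>2\<close> to the same multiple of the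
  form, so \<open>\<parallel>u v\<parallel>\<^sup>2\<close> cancels and the error is \<open>O(1/n)\<close> after division by \<open>n\<^sup>2\<close>.\<close>

lemma ex_almost_positive_summand:
  fixes A :: "'h::chilbert_space op set"
  assumes A: "operator_algebra A" and F: "cai_filter A F" and x: "x \<in> A" "re_ge (- \<epsilon>) x"
    and \<epsilon>: "\<epsilon> > 0" and \<delta>: "\<delta> > 0"
  shows "\<exists>y\<in>A. norm y \<le> 1 \<and> re_ge (- \<delta>) y \<and> re_ge (- \<delta>) (x + \<epsilon> *\<^sub>R y)"
proof -
  (* the defects are (1 + \<eta>) / n for y, and \<epsilon> * (1 + \<eta>) / n + 2 * \<eta> for x + \<epsilon> * y *)
  define \<eta> where "\<eta> = min 1 (\<delta> / 4)"
  have \<eta>: "0 < \<eta>" "\<eta> \<le> 1" "4 * \<eta> \<le> \<delta>"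
    using \<delta> by (auto simp: \<eta>_def)
  obtain n where "real n > 4 * (1 + \<epsilon>) / \<delta>"
    using reals_Archimedean2 by blast
  then have n: "4 * (1 + \<epsilon>) < \<delta> * real n"
    using \<delta> by (simp add: pos_divide_less_eq mult.commute)
  then have n0: "real n > 0"
    using \<epsilon> \<delta> by (metis add_pos_pos less_trans mult_pos_pos zero_less_mult_pos zero_less_numeral zero_less_one)
  from ex_sum_of_almost_units[OF A F x(1) \<eta>(1), of n]
  obtain u Y :: "'h op" where u: "u \<in> A" "Y \<in> A" "norm u \<le> real n" "2 * norm Y \<le> (real n)\<^sup>2"
    and uY: "\<And>v. (norm (u v))\<^sup>2 \<le> real n * (1 + \<eta>) * (norm v)\<^sup>2 + 2 * rinner (Y v) v"
    and xu: "norm ((x o\<^sub>L u) - real n *\<^sub>R x) \<le> real n * \<eta>"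
    and ux: "\<And>v w. \<bar>rinner (real n *\<^sub>R w - u w) (x v)\<bar> \<le> real n * \<eta> * norm w * norm v"
    by blast
  define y where "y = (2 / (real n)\<^sup>2) *\<^sub>R Y"
  have yY: "(real n)\<^sup>2 * rinner (y v) v = 2 * rinner (Y v) v" for v
    using n0 by (simp add: y_def blinfun.scaleR_left rinner.scaleR_left)
  have "y \<in> A"
    unfolding y_def using A u(2) by (rule operator_algebra_scaleR)
  moreover have "norm y \<le> 1"
    using u(4) n0 by (simp add: y_def pos_divide_le_eq)
  moreover have "- \<delta> * (norm v)\<^sup>2 \<le> rinner (y v) v \<and> - \<delta> * (norm v)\<^sup>2 \<le> rinner ((x + \<epsilon> *\<^sub>R y) v) v" for v
  proof -
    define a where "a = (norm v)\<^sup>2"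
    have a: "a \<ge> 0"
      by (simp add: a_def)
    have "norm (u v) \<le> norm u * norm v"
      by (rule norm_blinfun)
    also have "\<dots> \<le> real n * norm v"
      using u(3) by (intro mult_right_mono) auto
    finally have nu: "norm (u v) \<le> real n * norm v" .
    have "norm (((x o\<^sub>L u) - real n *\<^sub>R x) v) \<le> norm ((x o\<^sub>L u) - real n *\<^sub>R x) * norm v"
      by (rule norm_blinfun)
    also have "\<dots> \<le> real n * \<eta> * norm v"
      using xu by (intro mult_right_mono) auto
    finally have "norm (real n *\<^sub>R x v - x (u v)) \<le> real n * \<eta> * norm v"
      by (simp add: blinfun.diff_left blinfun.scaleR_left norm_minus_commute)
    then have "\<bar>rinner (u v) (real n *\<^sub>R x v - x (u v))\<bar> \<le> (real n * norm v) * (real n * \<eta> * norm v)"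
      using nu n0 by (intro order_trans[OF abs_rinner_le] mult_mono) auto
    then have 1: "\<bar>real n * rinner (u v) (x v) - rinner (u v) (x (u v))\<bar> \<le> (real n)\<^sup>2 * \<eta> * a"
      by (simp add: rinner.diff_right rinner.scaleR_right a_def power2_eq_square mult_ac)
    have "real n * \<bar>real n * rinner v (x v) - rinner (u v) (x v)\<bar> \<le> real n * (real n * \<eta> * norm v * norm v)"
      using ux[of v v] by (intro mult_left_mono) (simp_all add: rinner.diff_left rinner.scaleR_left)
    then have "\<bar>real n * (real n * rinner v (x v) - rinner (u v) (x v))\<bar> \<le> (real n)\<^sup>2 * \<eta> * a"
      by (simp add: abs_mult a_def power2_eq_square mult_ac)
    then have 2: "\<bar>(real n)\<^sup>2 * rinner v (x v) - real n * rinner (u v) (x v)\<bar> \<le> (real n)\<^sup>2 * \<eta> * a"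
      by (simp add: right_diff_distrib power2_eq_square)
    have 3: "- \<epsilon> * (norm (u v))\<^sup>2 \<le> rinner (u v) (x (u v))"
      using x(2) unfolding re_ge_def by (metis rinner_commute)
    have 4: "(norm (u v))\<^sup>2 - real n * (1 + \<eta>) * a \<le> (real n)\<^sup>2 * rinner (y v) v"
      using uY[of v] unfolding yY a_def by linarith
    from mult_left_mono[OF 4, of \<epsilon>]
    have 5: "\<epsilon> * (norm (u v))\<^sup>2 - \<epsilon> * (real n * (1 + \<eta>) * a) \<le> \<epsilon> * ((real n)\<^sup>2 * rinner (y v) v)"
      using \<epsilon> by (simp add: right_diff_distrib)
    have 6: "(real n)\<^sup>2 * rinner ((x + \<epsilon> *\<^sub>R y) v) v
        = (real n)\<^sup>2 * rinner v (x v) + \<epsilon> * ((real n)\<^sup>2 * rinner (y v) v)"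
      by (simp add: blinfun.add_left blinfun.scaleR_left rinner.add_left rinner.scaleR_left
          distrib_left rinner_commute[of v])
    have "real n * (1 + \<eta>) * a \<le> (real n)\<^sup>2 * (\<delta> * a)"
    proof -
      have "1 + \<eta> \<le> 4 * (1 + \<epsilon>)"
        using \<eta>(2) \<epsilon> by simp
      then have "1 + \<eta> \<le> \<delta> * real n"
        using n by (rule order_trans[OF _ less_imp_le])
      then have "(1 + \<eta>) * (real n * a) \<le> (\<delta> * real n) * (real n * a)"
        using n0 a by (intro mult_right_mono) auto
      then show ?thesis
        by (simp add: power2_eq_square mult_ac)
    qed
    then have "(real n)\<^sup>2 * (- \<delta> * a) \<le> (real n)\<^sup>2 * rinner (y v) v"
      using 4 zero_le_power2[of "norm (u v)"] unfolding mult_minus_left mult_minus_right by linarith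
    then have y1: "- \<delta> * a \<le> rinner (y v) v"
      using n0 by (subst (asm) mult_le_cancel_left_pos) auto
    have "\<epsilon> * (real n * (1 + \<eta>) * a) + 2 * ((real n)\<^sup>2 * \<eta> * a) \<le> (real n)\<^sup>2 * (\<delta> * a)"
    proof -
      have "\<epsilon> * (1 + \<eta>) \<le> \<epsilon> * 2"
        using \<epsilon> \<eta> by (intro mult_left_mono) auto
      moreover have "2 * \<eta> * real n \<le> \<delta> / 2 * real n"
        using \<eta>(3) n0 by (intro mult_right_mono) auto
      moreover have "\<epsilon> * 2 \<le> \<delta> / 2 * real n"
        using n by simp
      ultimately have "\<epsilon> * (1 + \<eta>) + 2 * \<eta> * real n \<le> \<delta> / 2 * real n + \<delta> / 2 * real n"
        by linarith
      then have "\<epsilon> * (1 + \<eta>) + 2 * \<eta> * real n \<le> \<delta> * real n"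
        by simp
      then have "(\<epsilon> * (1 + \<eta>) + 2 * \<eta> * real n) * (real n * a) \<le> (\<delta> * real n) * (real n * a)"
        using n0 a by (intro mult_right_mono) auto
      then show ?thesis
        by (simp add: power2_eq_square algebra_simps)
    qed
    then have "(real n)\<^sup>2 * (- \<delta> * a) \<le> (real n)\<^sup>2 * rinner ((x + \<epsilon> *\<^sub>R y) v) v"
      using 1 2 3 5 unfolding 6 abs_le_iff mult_minus_left mult_minus_right by linarith
    then have "- \<delta> * a \<le> rinner ((x + \<epsilon> *\<^sub>R y) v) v"
      using n0 by (subst (asm) mult_le_cancel_left_pos) auto
    with y1 show ?thesis
      unfolding a_def by blast
  qed
  ultimately show ?thesis
    unfolding re_ge_def by blast
qed

text \<open>Each correction has at most the size of the current defect, and it can be chosen to halve the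
  defect; so the corrections form a convergent series whose limit has no defect left.\<close>

lemma ex_accretive_near:
  fixes A :: "'h::chilbert_space op set"
  assumes A: "operator_algebra A" and F: "cai_filter A F" and x: "x \<in> A" "re_ge (- \<epsilon>) x"
    and \<epsilon>: "\<epsilon> > 0"
  shows "\<exists>w\<in>A. accretive w \<and> norm (w - x) \<le> 2 * \<epsilon>"
proof -
  define c where "c n = \<epsilon> * (1 / 2) ^ n" for n :: nat
  have c: "c n > 0" for n
    using \<epsilon> by (simp add: c_def)
  have "\<exists>X. \<forall>n. (X n \<in> A \<and> re_ge (- c n) (X n) \<and> (n = 0 \<longrightarrow> X n = x)) \<and> norm (X (Suc n) - X n) \<le> c n"
  proof (rule dependent_nat_choice)
    show "\<exists>z. z \<in> A \<and> re_ge (- c 0) z \<and> (0 = (0 :: nat) \<longrightarrow> z = x)"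
      using x by (simp add: c_def)
    fix z n assume z: "z \<in> A \<and> re_ge (- c n) z \<and> (n = 0 \<longrightarrow> z = x)"
    then obtain y where y: "y \<in> A" "norm y \<le> 1" "re_ge (- c (Suc n)) (z + c n *\<^sub>R y)"
      using ex_almost_positive_summand[OF A F, of z "c n" "c (Suc n)"] c by blast
    have "norm ((z + c n *\<^sub>R y) - z) \<le> c n"
      using mult_left_mono[OF y(2), of "c n"] c[of n] by simp
    moreover have "z + c n *\<^sub>R y \<in> A"
      using z y(1) by (intro operator_algebra_add[OF A] operator_algebra_scaleR[OF A]) auto
    ultimately show "\<exists>z'. (z' \<in> A \<and> re_ge (- c (Suc n)) z' \<and> (Suc n = 0 \<longrightarrow> z' = x)) \<and> norm (z' - z) \<le> c n"
      using y(3) by (intro exI[of _ "z + c n *\<^sub>R y"]) simp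
  qed
  then obtain X where X: "\<And>n. X n \<in> A" "\<And>n. re_ge (- c n) (X n)" "X 0 = x"
    and step: "\<And>n. norm (X (Suc n) - X n) \<le> c n"
    by metis
  have sc: "summable c" "suminf c = 2 * \<epsilon>"
    unfolding c_def by (auto simp: suminf_mult suminf_geometric intro: summable_mult)
  define s where "s = (\<Sum>n. X (Suc n) - X n)"
  have "summable (\<lambda>n. X (Suc n) - X n)"
    using step by (intro summable_comparison_test'[OF sc(1)])
  then have "(\<lambda>n. \<Sum>k<n. X (Suc k) - X k) \<longlonglongrightarrow> s"
    unfolding s_def by (rule summable_LIMSEQ)
  then have "(\<lambda>n. (X n - x) + x) \<longlonglongrightarrow> s + x"
    unfolding sum_lessThan_telescope X(3) by (intro tendsto_add tendsto_const)
  then have lim: "X \<longlonglongrightarrow> s + x"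
    by simp
  have "closed A"
    using A by (simp add: operator_algebra_def)
  then have "s + x \<in> A"
    using X(1) lim by (rule closed_sequentially)
  moreover have "norm ((s + x) - x) \<le> 2 * \<epsilon>"
    using norm_suminf_le[OF step sc(1)] sc(2) by (simp add: s_def)
  moreover have "0 * (norm v)\<^sup>2 \<le> rinner ((s + x) v) v" for v
  proof (rule LIMSEQ_le)
    have "c \<longlonglongrightarrow> 0"
      by (rule summable_LIMSEQ_zero[OF sc(1)])
    then have "(\<lambda>n. - c n * (norm v)\<^sup>2) \<longlonglongrightarrow> - 0 * (norm v)\<^sup>2"
      by (intro tendsto_intros)
    then show "(\<lambda>n. - c n * (norm v)\<^sup>2) \<longlonglongrightarrow> 0 * (norm v)\<^sup>2"
      by simp
    show "(\<lambda>n. rinner (X n v) v) \<longlonglongrightarrow> rinner ((s + x) v) v"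
      by (intro rinner.tendsto blinfun.tendsto lim tendsto_const)
    show "\<exists>N. \<forall>n\<ge>N. - c n * (norm v)\<^sup>2 \<le> rinner (X n v) v"
      using X(2) by (simp add: re_ge_def)
  qed
  ultimately show ?thesis
    unfolding re_ge_def by blast
qed

text \<open>Apply the preceding results to \<open>y\<close> and \<open>a + M y\<close> for the same \<open>y\<close>: accretive \<open>q\<close> and \<open>p\<close>
  close to them give \<open>a \<approx> p - M q\<close>.\<close>

lemma dense_span_of_cai:
  fixes A :: "'h::chilbert_space op set"
  assumes A: "operator_algebra A" and F: "cai_filter A F"
  shows "A \<subseteq> closure (op.span {x \<in> A. norm (id_blinfun - x) \<le> 1})" (is "_ \<subseteq> closure ?S")
proof
  fix a assume a: "a \<in> A"
  show "a \<in> closure ?S"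
    unfolding closure_approachable
  proof (intro allI impI)
    fix d :: real assume d: "d > 0"
    define M where "M = norm a + 1"
    define \<delta> where "\<delta> = d / (4 * (1 + M))"
    have M: "M > 0" "norm a \<le> M"
      by (simp_all add: M_def add_nonneg_pos)
    have "4 * (\<delta> + M * \<delta>) = \<delta> * (4 * (1 + M))"
      by (simp add: algebra_simps)
    also have "\<dots> = d"
      using M(1) by (simp add: \<delta>_def)
    finally have \<delta>: "\<delta> > 0" "4 * (\<delta> + M * \<delta>) = d"
      using M(1) d by (simp_all add: \<delta>_def)
    have "re_ge (- M) a"
      by (rule re_ge_mono[OF re_ge_norm]) (use M in simp)
    then obtain y where y: "y \<in> A" "re_ge (- \<delta>) y" "re_ge (- \<delta>) (a + M *\<^sub>R y)"
      using ex_almost_positive_summand[OF A F a _ M(1) \<delta>(1)] by blast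
    have "a + M *\<^sub>R y \<in> A"
      by (intro operator_algebra_add[OF A] operator_algebra_scaleR[OF A] a y)
    from ex_accretive_near[OF A F this y(3) \<delta>(1)] ex_accretive_near[OF A F y(1,2) \<delta>(1)]
    obtain p q where p: "p \<in> A" "accretive p" "norm (p - (a + M *\<^sub>R y)) \<le> 2 * \<delta>"
      and q: "q \<in> A" "accretive q" "norm (q - y) \<le> 2 * \<delta>"
      by blast
    obtain p' where p': "p' \<in> ?S" "dist p' p < \<delta>"
      using accretive_in_closure_span[OF A p(1,2)] \<delta>(1) unfolding closure_approachable by blast
    obtain q' where q': "q' \<in> ?S" "dist q' q < \<delta>"
      using accretive_in_closure_span[OF A q(1,2)] \<delta>(1) unfolding closure_approachable by blast
    have "p' - M *\<^sub>R q' \<in> ?S"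
      unfolding scale_op_of_real[symmetric] by (rule op.span_diff[OF p'(1) op.span_scale[OF q'(1)]])
    moreover have "dist (p' - M *\<^sub>R q') a < d"
    proof -
      have "norm (p' - (a + M *\<^sub>R y)) < 3 * \<delta>"
        using dist_triangle[of p' "a + M *\<^sub>R y" p] p(3) p'(2) unfolding dist_norm by linarith
      moreover have "norm (q' - y) < 3 * \<delta>"
        using dist_triangle[of q' y q] q(3) q'(2) unfolding dist_norm by linarith
      then have "norm (M *\<^sub>R (q' - y)) \<le> M * (3 * \<delta>)"
        using M(1) by simp
      moreover have eq: "(p' - M *\<^sub>R q') - a = (p' - (a + M *\<^sub>R y)) - M *\<^sub>R (q' - y)"
        by (simp add: scaleR_diff_right)
      ultimately have "norm ((p' - M *\<^sub>R q') - a) < 3 * \<delta> + M * (3 * \<delta>)"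
        using norm_triangle_ineq4[of "p' - (a + M *\<^sub>R y)" "M *\<^sub>R (q' - y)"]
        unfolding eq by linarith
      moreover have "M * \<delta> > 0"
        using M(1) \<delta>(1) by simp
      ultimately show ?thesis
        using \<delta> unfolding dist_norm distrib_left mult.left_commute[of M] by linarith
    qed
    ultimately show "\<exists>s\<in>?S. dist s a < d"
      by blast
  qed
qed

section \<open>The characterization\<close>

text \<open>If \<open>A\<close> has an identity \<open>e\<close> of norm 1, then \<open>e - x = e (id - x)\<close> for \<open>x \<in> A\<close>.\<close>

lemma F_set_superset:
  assumes A: "operator_algebra A"
  shows "{x \<in> A. norm (id_blinfun - x) \<le> 1} \<subseteq> F_set A"
proof (cases "\<exists>e. is_identity A e \<and> norm e = 1")
  case True
  then obtain e where e: "is_identity A e" "norm e = 1"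
    by blast
  have "norm (e - x) \<le> 1" if x: "x \<in> A" "norm (id_blinfun - x) \<le> 1" for x
  proof -
    have "e - x = e o\<^sub>L (id_blinfun - x)"
      using e(1) x(1) by (simp add: is_identity_def compose_simps)
    then have "norm (e - x) \<le> norm e * norm (id_blinfun - x)"
      by (simp only: norm_blinfun_compose)
    then show ?thesis
      using e(2) x(2) by simp
  qed
  then show ?thesis
    using unit_of_eq[OF e] by (auto simp: F_set_def)
next
  case False
  then show ?thesis
    using unit_of_eq_id[OF A] by (auto simp: F_set_def)
qed

lemma has_cai_of_identity:
  assumes "is_identity A e" "norm e = 1"
  shows "has_cai A"
  by (rule filter_imp_has_cai[of "principal {e}"])
    (use assms in \<open>auto simp: is_identity_def eventually_principal tendsto_principal_singleton principal_eq_bot_iff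
      intro!: tendsto_eventually\<close>)

theorem proposition4p1:
  fixes A :: "'h::chilbert_space op set"
  assumes "operator_algebra A"
  shows "has_cai A \<longleftrightarrow> A \<subseteq> closure (op.span (F_set A))"
proof
  assume "has_cai A"
  then obtain F where "cai_filter A F"
    unfolding has_cai_def cai_filter_def using is_cai_imp_filter by blast
  then have "A \<subseteq> closure (op.span {x \<in> A. norm (id_blinfun - x) \<le> 1})"
    by (rule dense_span_of_cai[OF assms])
  also have "\<dots> \<subseteq> closure (op.span (F_set A))"
    by (intro closure_mono op.span_mono F_set_superset assms)
  finally show "A \<subseteq> closure (op.span (F_set A))" .
next
  assume dense: "A \<subseteq> closure (op.span (F_set A))"
  show "has_cai A"
  proof (cases "\<exists>e. is_identity A e \<and> norm e = 1")
    case True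
    then show ?thesis
      using has_cai_of_identity by blast
  next
    case False
    then have "F_set A = {x \<in> A. norm (id_blinfun - x) \<le> 1}"
      using unit_of_eq_id[OF assms] by (simp add: F_set_def)
    then show ?thesis
      using has_cai_of_dense_span[OF assms] dense by simp
  qed
qed

end
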